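(* Let $\mathcal H$ be a complex Hilbert space and let $\mathbf A=(A_1,\dots,A_m)$ be an $m$-tuple of compact operators on $\mathcal H$. Then $\{A_1,\dots,A_m\}$ is a commuting family of normal operators if and only if $$W_k(\mathbf A)=\operatorname{conv}\Sigma_k(\mathbf A)\qquad\text{for every positive integer }k<\dim\mathcal H.$$
   Context: For an $m$-tuple $\mathbf A=(A_1,\dots,A_m)$ of bounded operators on a complex Hilbert space $\mathcal H$ and a positive integer $k\le\dim\mathcal H$, the joint $k$-numerical range is $$W_k(\mathbf A)=\Big\{\Big(\sum_{\ell=1}^k\langle A_1x_\ell,x_\ell\rangle,\dots,\sum_{\ell=1}^k\langle A_mx_\ell,x_\ell\rangle\Big):\{x_1,\dots,x_k\}\subseteq\mathcal H\text{ orthonormal}\Big\}\subseteq\mathbb C^m.$$ A point $\mu=(\mu_1,\dots,\mu_m)\in\mathbb C^m$ is a joint eigenvalue of $\mathbf A$ if there is a nonzero $x\in\mathcal H$ (a common eigenvector corresponding to $\mu$) with $A_jx=\mu_jx$ for all $j=1,\dots,m$. $\Sigma_k(\mathbf A)$ is the set of all sums $\mu^{(1)}+\cdots+\mu^{(k)}$, where $\mu^{(1)},\dots,\mu^{(k)}$ are joint eigenvalues of $\mathbf A$ (not necessarily distinct) corresponding to $k$ linearly independent common eigenvectors $x_1,\dots,x_k$; this set may be empty. $\operatorname{conv}$ denotes convex hull. *)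

theory Defs
  imports "HOL-Analysis.Analysis" "HOL-Library.Extended_Nat"
begin

class complex_vector = real_vector +
  fixes scaleC :: "complex \<Rightarrow> 'a \<Rightarrow> 'a"  (infixr "*\<^sub>C" 75)
  assumes scaleC_add_right: "c *\<^sub>C (x + y) = c *\<^sub>C x + c *\<^sub>C y"
    and scaleC_add_left: "(c + d) *\<^sub>C x = c *\<^sub>C x + d *\<^sub>C x"
    and scaleC_scaleC: "c *\<^sub>C (d *\<^sub>C x) = (c * d) *\<^sub>C x"
    and scaleC_one: "1 *\<^sub>C x = x"
    and scaleR_scaleC: "r *\<^sub>R x = complex_of_real r *\<^sub>C x"

global_interpretation complex_vector: vector_space "scaleC :: complex \<Rightarrow> 'a \<Rightarrow> 'a::complex_vector"
  by unfold_locales (simp_all add: scaleC_add_right scaleC_add_left scaleC_scaleC scaleC_one)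

text \<open>
  The complex inner product is linear in the first argument. Positivity, definiteness and
  \<open>norm x = sqrt (Re (cinner x x))\<close> are inherited from \<open>real_inner\<close>, whose real inner product is
  required to be the real part of the complex one.
\<close>

class complex_inner = complex_vector + real_inner +
  fixes cinner :: "'a \<Rightarrow> 'a \<Rightarrow> complex"
  assumes cinner_commute: "cinner x y = cnj (cinner y x)"
    and cinner_add_left: "cinner (x + y) z = cinner x z + cinner y z"
    and cinner_scaleC_left: "cinner (c *\<^sub>C x) y = c * cinner x y"
    and inner_eq_Re_cinner: "inner x y = Re (cinner x y)"

class complex_hilbert = complex_inner + complete_space

lemma cinner_self: "cinner x x = complex_of_real ((norm x)\<^sup>2)"
  for x :: "'a::complex_inner"
  using cinner_commute[of x x] inner_eq_Re_cinner[of x x]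
  by (simp add: complex_eq_iff dot_square_norm)

instantiation complex :: complex_hilbert
begin

definition "scaleC c (z::complex) = c * z"

definition "cinner w (z::complex) = w * cnj z"

instance
  by standard
    (simp_all add: scaleC_complex_def cinner_complex_def algebra_simps scaleR_conv_of_real
      inner_complex_def)

end

instantiation vec :: (complex_hilbert, finite) complex_hilbert
begin

definition "scaleC c (x::'a^'b) = (\<chi> i. c *\<^sub>C x $ i)"

definition "cinner x (y::'a^'b) = (\<Sum>i\<in>UNIV. cinner (x $ i) (y $ i))"

instance
proof
  fix x y :: "'a^'b"
  show "cinner x y = cnj (cinner y x)"
    by (simp add: cinner_vec_def cinner_commute[symmetric])
qed (simp_all add: scaleC_vec_def cinner_vec_def vec_eq_iff scaleC_add_right scaleC_add_left
      scaleC_scaleC scaleC_one scaleR_scaleC cinner_add_left cinner_scaleC_left sum.distrib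
      sum_distrib_left inner_vec_def inner_eq_Re_cinner)

end

text \<open>
  The library's \<open>dim\<close> is \<open>0\<close> on infinite-dimensional spaces. Only comparisons with natural
  numbers are needed, so all infinite dimensions are identified with \<open>\<infinity>\<close>; with this convention
  the linear dimension and the Hilbert dimension (cardinality of an orthonormal basis) coincide.
\<close>

definition hilbert_dim :: "'a::complex_hilbert itself \<Rightarrow> enat" where
  "hilbert_dim _ =
    (if \<exists>B::'a set. finite B \<and> complex_vector.span B = UNIV
     then enat (complex_vector.dim (UNIV :: 'a set)) else \<infinity>)"

definition bounded_operator :: "('a::complex_hilbert \<Rightarrow> 'a) \<Rightarrow> bool" where
  "bounded_operator T \<longleftrightarrow> bounded_linear T \<and> (\<forall>c x. T (c *\<^sub>C x) = c *\<^sub>C T x)"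

definition compact_operator :: "('a::complex_hilbert \<Rightarrow> 'a) \<Rightarrow> bool" where
  "compact_operator T \<longleftrightarrow> bounded_operator T \<and> (\<forall>S. bounded S \<longrightarrow> compact (closure (T ` S)))"

text \<open>For bounded operators the adjoint exists and is unique by Riesz representation.\<close>

definition hilbert_adjoint :: "('a::complex_hilbert \<Rightarrow> 'a) \<Rightarrow> 'a \<Rightarrow> 'a" where
  "hilbert_adjoint T = (THE S. \<forall>x y. cinner (T x) y = cinner x (S y))"

definition normal_operator :: "('a::complex_hilbert \<Rightarrow> 'a) \<Rightarrow> bool" where
  "normal_operator T \<longleftrightarrow>
    bounded_operator T \<and> T \<circ> hilbert_adjoint T = hilbert_adjoint T \<circ> T"

definition orthonormal_family :: "nat \<Rightarrow> (nat \<Rightarrow> 'a::complex_hilbert) \<Rightarrow> bool" where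
  "orthonormal_family k x \<longleftrightarrow> (\<forall>i<k. \<forall>l<k. cinner (x i) (x l) = (if i = l then 1 else 0))"

definition independent_family :: "nat \<Rightarrow> (nat \<Rightarrow> 'a::complex_vector) \<Rightarrow> bool" where
  "independent_family k x \<longleftrightarrow> inj_on x {..<k} \<and> complex_vector.independent (x ` {..<k})"

definition joint_numerical_range ::
    "nat \<Rightarrow> ('m::finite \<Rightarrow> 'a::complex_hilbert \<Rightarrow> 'a) \<Rightarrow> (complex^'m) set" where
  "joint_numerical_range k A =
    {\<chi> j. \<Sum>l<k. cinner (A j (x l)) (x l) | x. orthonormal_family k x}"

definition common_eigenvector ::
    "('m::finite \<Rightarrow> 'a::complex_hilbert \<Rightarrow> 'a) \<Rightarrow> complex^'m \<Rightarrow> 'a \<Rightarrow> bool" where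
  "common_eigenvector A \<mu> x \<longleftrightarrow> x \<noteq> 0 \<and> (\<forall>j. A j x = (\<mu> $ j) *\<^sub>C x)"

definition joint_eigenvalue_sums ::
    "nat \<Rightarrow> ('m::finite \<Rightarrow> 'a::complex_hilbert \<Rightarrow> 'a) \<Rightarrow> (complex^'m) set" where
  "joint_eigenvalue_sums k A =
    {\<Sum>l<k. \<mu> l | \<mu> x. independent_family k x \<and> (\<forall>l<k. common_eigenvector A (\<mu> l) (x l))}"

end

theory Submission
  imports Defs
begin

text \<open>
  If the operators commute and are normal, Fuglede's theorem lets one diagonalise all real and
  imaginary parts in a common orthonormal basis \<open>E\<close>. A point of the joint \<open>k\<close>-numerical range is
  then a series \<open>\<Sum> p e *\<^sub>R \<mu> e\<close> with weights \<open>0 \<le> p e \<le> 1\<close> of total mass \<open>k\<close>. Although the series may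
  be infinite, it lies in the convex hull (not only its closure) of the sums of \<open>\<mu>\<close> over \<open>k\<close>-element
  subsets of \<open>E\<close>: otherwise a separating functional forces some of the weights to be \<open>1\<close>, and
  induction on \<open>k\<close> applies. Conversely, finitely supported weights are the diagonals of projections of
  rank \<open>k\<close>.

  For the other implication, apply the hypothesis to each linear combination \<open>T\<close> of two of the
  operators. The trace of \<open>T + T*\<close> over its top eigenvectors is maximal, hence also attained on
  a space spanned by \<open>k\<close> eigenvectors of \<open>T\<close>; the equality case of Ky Fan's inequality identifies the
  two spaces, so the eigenspaces of \<open>T + T*\<close> reduce \<open>T\<close> and \<open>T\<close> is normal. Polarisation and Fuglede's
  theorem then give commutativity.
\<close>

subsection \<open>Complex inner products\<close>

text \<open>The hull of the eigenvalue sums is in general not closed: joint eigenvalues may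
  accumulate at 0 without 0 being one of them. A limiting argument would only reach the closure, and
  a point outside the hull can only be separated weakly. A functional in the linear span of the
  translated hull is therefore chosen, so that it cannot be constant there. For the converse, the
  strict bound on \<open>k\<close> costs nothing: comparing an eigenvector with one of smaller
  eigenvalue always leaves the latter outside the chosen \<open>k\<close> vectors. Compactness
  leaves only finitely many eigenvectors of the real part above a positive threshold. Of two
  distinct eigenvalues, either the larger is positive or the smaller is negative, and the second
  case is the first one for \<open>- T\<close>. The eigenvectors behind an eigenvalue sum are merely
  independent, as normality is not yet known; orthonormalising them makes the operator triangular
  and keeps its diagonal. Complex linear combinations enter because normality of each operator alone
  says nothing about commutation.\<close>

lemma cinner_add_right: "cinner x (y + z) = cinner x y + cinner x z"
  for x :: "'a::complex_inner"
  by (metis cinner_add_left cinner_commute complex_cnj_add)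

lemma cinner_scaleC_right: "cinner x (c *\<^sub>C y) = cnj c * cinner x y"
  for x :: "'a::complex_inner"
  by (metis cinner_commute cinner_scaleC_left complex_cnj_mult)

lemma cinner_scaleR_left: "cinner (r *\<^sub>R x) y = complex_of_real r * cinner x y"
  for x :: "'a::complex_inner"
  by (simp add: scaleR_scaleC cinner_scaleC_left)

lemma cinner_scaleR_right: "cinner x (r *\<^sub>R y) = complex_of_real r * cinner x y"
  for x :: "'a::complex_inner"
  by (simp add: scaleR_scaleC cinner_scaleC_right)

lemma cinner_zero_left [simp]: "cinner 0 x = 0" for x :: "'a::complex_inner"
  using cinner_add_left[of 0 0 x] by simp

lemma cinner_zero_right [simp]: "cinner x 0 = 0" for x :: "'a::complex_inner"
  using cinner_add_right[of x 0 0] by simp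

lemma cinner_minus_left: "cinner (- x) y = - cinner x y" for x :: "'a::complex_inner"
  using cinner_add_left[of x "- x" y] by (simp add: add_eq_0_iff)

lemma cinner_minus_right: "cinner x (- y) = - cinner x y" for x :: "'a::complex_inner"
  using cinner_add_right[of x y "- y"] by (simp add: add_eq_0_iff)

lemma cinner_diff_left: "cinner (x - y) z = cinner x z - cinner y z"
  for x :: "'a::complex_inner"
  using cinner_add_left[of x "- y" z] by (simp add: cinner_minus_left)

lemma cinner_diff_right: "cinner x (y - z) = cinner x y - cinner x z"
  for x :: "'a::complex_inner"
  using cinner_add_right[of x y "- z"] by (simp add: cinner_minus_right)

lemma cinner_sum_left: "cinner (sum f A) y = (\<Sum>i\<in>A. cinner (f i) y)"
  for y :: "'a::complex_inner"
  by (induction A rule: infinite_finite_induct) (simp_all add: cinner_add_left)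

lemma cinner_sum_right: "cinner y (sum f A) = (\<Sum>i\<in>A. cinner y (f i))"
  for y :: "'a::complex_inner"
  by (induction A rule: infinite_finite_induct) (simp_all add: cinner_add_right)

lemmas cinner_simps = cinner_add_left cinner_add_right cinner_diff_left cinner_diff_right
  cinner_scaleC_left cinner_scaleC_right cinner_minus_left cinner_minus_right
  cinner_scaleR_left cinner_scaleR_right

lemma cinner_zero_commute: "cinner x y = 0 \<longleftrightarrow> cinner y x = 0" for x :: "'a::complex_inner"
  by (metis cinner_commute complex_cnj_zero)

lemma cinner_eq_zero_iff [simp]: "cinner x x = 0 \<longleftrightarrow> x = 0" for x :: "'a::complex_inner"
  by (simp add: cinner_self)

lemma cinner_ext: "x = y" if "\<And>z. cinner x z = cinner y z" for x y :: "'a::complex_inner"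
  using that[of "x - y"] cinner_eq_zero_iff[of "x - y"] by (simp add: cinner_diff_left)

lemma cmod_cinner_commute: "cmod (cinner x y) = cmod (cinner y x)" for x :: "'a::complex_inner"
  by (metis cinner_commute complex_mod_cnj)

lemma norm_scaleC: "norm (c *\<^sub>C x) = cmod c * norm x" for x :: "'a::complex_inner"
proof -
  have "complex_of_real ((norm (c *\<^sub>C x))\<^sup>2) = (c * cnj c) * complex_of_real ((norm x)\<^sup>2)"
    by (simp only: cinner_self[symmetric] cinner_simps mult_ac)
  also have "\<dots> = complex_of_real ((cmod c * norm x)\<^sup>2)"
    by (simp only: of_real_mult power_mult_distrib complex_norm_square)
  finally have "(norm (c *\<^sub>C x))\<^sup>2 = (cmod c * norm x)\<^sup>2"
    using of_real_eq_iff by blast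
  then show ?thesis
    by (simp add: power2_eq_iff_nonneg)
qed

text \<open>A unimodular factor \<open>c\<close> rotates the complex inner product onto the positive
  real axis, which reduces the claim to the real Cauchy--Schwarz inequality.\<close>

lemma norm_cinner_le: "cmod (cinner x y) \<le> norm x * norm y" for x :: "'a::complex_inner"
proof (cases "cinner x y = 0")
  case False
  define r where "r = cmod (cinner x y)"
  define c where "c = cnj (cinner x y) / complex_of_real r"
  have r: "r \<noteq> 0" using False by (simp add: r_def)
  have "cnj (cinner x y) * cinner x y = complex_of_real r * complex_of_real r"
    using complex_norm_square[of "cinner x y"] by (simp add: r_def power2_eq_square mult.commute)
  then have "c * cinner x y = complex_of_real (cmod (cinner x y))"
    using r by (simp add: c_def field_simps flip: r_def)
  then have "cmod (cinner x y) = inner (c *\<^sub>C x) y"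
    by (simp add: inner_eq_Re_cinner cinner_scaleC_left)
  also have "\<dots> \<le> norm (c *\<^sub>C x) * norm y"
    by (rule norm_cauchy_schwarz)
  also have "\<dots> = norm x * norm y"
    using r by (simp add: norm_scaleC c_def norm_divide r_def)
  finally show ?thesis .
qed simp

lemma bounded_linear_cinner_left: "bounded_linear (\<lambda>x. cinner x y)" for y :: "'a::complex_inner"
  by (rule bounded_linear_intro[where K = "norm y"])
    (simp_all add: cinner_simps scaleR_conv_of_real norm_cinner_le)

lemma bounded_linear_scaleC: "bounded_linear (\<lambda>x::'a::complex_inner. c *\<^sub>C x)"
proof (rule bounded_linear_intro[where K = "cmod c"])
  show "c *\<^sub>C (r *\<^sub>R x) = r *\<^sub>R (c *\<^sub>C x)" for r and x :: 'a
    by (simp add: scaleR_scaleC scaleC_scaleC mult.commute)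
qed (simp_all add: scaleC_add_right norm_scaleC mult.commute)

lemma norm_add_pythagoras:
  fixes x :: "'a::complex_inner"
  assumes "cinner x y = 0"
  shows "(norm (x + y))\<^sup>2 = (norm x)\<^sup>2 + (norm y)\<^sup>2"
  using assms by (simp add: norm_add_Pythagorean orthogonal_def inner_eq_Re_cinner)

subsection \<open>Orthogonal projections and the Riesz representation\<close>

lemma closest_point_in_complete_subspace:
  fixes M :: "'a::complex_hilbert set"
  assumes sub: "complex_vector.subspace M" and cl: "closed M"
  obtains y where "y \<in> M" and "\<And>z. z \<in> M \<Longrightarrow> norm (x - y) \<le> norm (x - z)"
proof -
  define d where "d = (INF z\<in>M. norm (x - z))"
  have ne: "M \<noteq> {}" using complex_vector.subspace_0[OF sub] by auto
  have bdd: "bdd_below ((\<lambda>z. norm (x - z)) ` M)" by (rule bdd_belowI2[of _ 0]) simp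
  have d_le: "d \<le> norm (x - z)" if "z \<in> M" for z
    unfolding d_def using bdd that by (rule cINF_lower)
  have d0: "0 \<le> d" unfolding d_def by (rule cINF_greatest[OF ne]) simp
  have "\<exists>z\<in>M. norm (x - z) < d + 1 / real (Suc n)" for n
    using cINF_less_iff[OF ne bdd, of "d + 1 / real (Suc n)"] d_def
    by (metis less_add_same_cancel1 of_nat_0_less_iff zero_less_Suc zero_less_divide_1_iff)
  then obtain y where yM: "\<And>n. y n \<in> M" and yd: "\<And>n. norm (x - y n) < d + 1 / real (Suc n)"
    by metis
  \<comment> \<open>The parallelogram law for \<open>x - y m\<close> and \<open>x - y n\<close>; the
    midpoint of \<open>y m\<close> and \<open>y n\<close> lies in \<open>M\<close>, hence at
    distance at least \<open>d\<close> from \<open>x\<close>.\<close>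
  have half: "(norm (y m - y n))\<^sup>2 \<le> 2 * (norm (x - y m))\<^sup>2 + 2 * (norm (x - y n))\<^sup>2 - 4 * d\<^sup>2" for m n
  proof -
    have "(1/2) *\<^sub>R (y m + y n) \<in> M"
      using sub yM by (simp add: scaleR_scaleC complex_vector.subspace_add complex_vector.subspace_scale)
    then have "d \<le> norm (x - (1/2) *\<^sub>R (y m + y n))" by (rule d_le)
    also have "x - (1/2) *\<^sub>R (y m + y n) = (1/2) *\<^sub>R ((x - y m) + (x - y n))"
      by (simp add: algebra_simps) (metis scaleR_half_double scaleR_add_right)
    finally have "2 * d \<le> norm ((x - y m) + (x - y n))" by simp
    then have "4 * d\<^sup>2 \<le> (norm ((x - y m) + (x - y n)))\<^sup>2"
      using d0 power_mono[of "2*d" _ 2] by (simp add: power_mult_distrib)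
    moreover have "(norm ((x - y m) + (x - y n)))\<^sup>2 + (norm ((x - y n) - (x - y m)))\<^sup>2
        = 2 * (norm (x - y m))\<^sup>2 + 2 * (norm (x - y n))\<^sup>2"
      by (simp only: power2_norm_eq_inner inner_simps inner_commute) (simp add: inner_commute algebra_simps)
    ultimately show ?thesis by (simp add: algebra_simps)
  qed
  have lim: "(\<lambda>n. norm (x - y n)) \<longlonglongrightarrow> d"
  proof (rule tendsto_sandwich[of "\<lambda>_. d" _ _ "\<lambda>n. d + 1 / real (Suc n)"])
    show "(\<lambda>n. d + 1 / real (Suc n)) \<longlonglongrightarrow> d"
      using tendsto_add[OF tendsto_const[of d] LIMSEQ_inverse_real_of_nat] by (simp add: inverse_eq_divide)
    show "\<forall>\<^sub>F n in sequentially. norm (x - y n) \<le> d + 1 / real (Suc n)"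
      by (intro always_eventually allI less_imp_le yd)
  qed (auto intro!: always_eventually d_le yM)
  have "Cauchy y"
  proof (rule metric_CauchyI)
    fix e :: real assume e: "e > 0"
    have "(\<lambda>n. 4 * ((norm (x - y n))\<^sup>2 - d\<^sup>2)) \<longlonglongrightarrow> 4 * (d\<^sup>2 - d\<^sup>2)"
      by (intro tendsto_intros lim)
    then have "\<forall>\<^sub>F n in sequentially. 4 * ((norm (x - y n))\<^sup>2 - d\<^sup>2) < e\<^sup>2"
      by (rule order_tendstoD(2)) (use e in simp)
    then obtain N where N: "\<And>n. n \<ge> N \<Longrightarrow> 4 * ((norm (x - y n))\<^sup>2 - d\<^sup>2) < e\<^sup>2"
      by (auto simp: eventually_sequentially)
    have "dist (y m) (y n) < e" if "m \<ge> N" "n \<ge> N" for m n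
    proof -
      have "(norm (y m - y n))\<^sup>2 < e\<^sup>2" using half[of m n] N[OF that(1)] N[OF that(2)] by simp
      then show ?thesis using e by (simp add: dist_norm power_less_imp_less_base)
    qed
    then show "\<exists>N. \<forall>m\<ge>N. \<forall>n\<ge>N. dist (y m) (y n) < e" by blast
  qed
  then obtain l where l: "y \<longlonglongrightarrow> l" using Cauchy_convergent convergent_def by blast
  have "l \<in> M" using cl l yM closed_sequential_limits by blast
  moreover have "norm (x - l) = d"
  proof (rule LIMSEQ_unique[OF _ lim])
    show "(\<lambda>n. norm (x - y n)) \<longlonglongrightarrow> norm (x - l)" by (intro tendsto_intros l)
  qed
  ultimately show thesis using that d_le by simp
qed

text \<open>With \<open>y\<close> closest to \<open>x\<close>, removing from \<open>x - y\<close>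
  its component along \<open>z\<close> cannot shorten it, whereas by Pythagoras a nonzero component
  would.\<close>

lemma orthogonal_decomposition:
  fixes M :: "'a::complex_hilbert set"
  assumes sub: "complex_vector.subspace M" and cl: "closed M"
  obtains y where "y \<in> M" and "\<And>z. z \<in> M \<Longrightarrow> cinner (x - y) z = 0"
proof -
  obtain y where yM: "y \<in> M" and min: "\<And>z. z \<in> M \<Longrightarrow> norm (x - y) \<le> norm (x - z)"
    using closest_point_in_complete_subspace[OF assms] by blast
  have "cinner (x - y) z = 0" if z: "z \<in> M" for z
  proof (cases "z = 0")
    case False
    define c where "c = cinner (x - y) z / complex_of_real ((norm z)\<^sup>2)"
    define u where "u = x - y - c *\<^sub>C z"
    have uz: "cinner u z = 0"
      using False by (simp add: u_def c_def cinner_simps cinner_self)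
    have "y + c *\<^sub>C z \<in> M" using sub yM z by (simp add: complex_vector.subspace_add complex_vector.subspace_scale)
    then have "norm (x - y) \<le> norm u" using min[of "y + c *\<^sub>C z"] by (simp add: u_def algebra_simps)
    moreover have "(norm (u + c *\<^sub>C z))\<^sup>2 = (norm u)\<^sup>2 + (norm (c *\<^sub>C z))\<^sup>2"
      by (rule norm_add_pythagoras) (simp add: cinner_simps uz)
    moreover have "u + c *\<^sub>C z = x - y" by (simp add: u_def)
    ultimately have "(norm (c *\<^sub>C z))\<^sup>2 \<le> 0"
      using power_mono[of "norm (x - y)" "norm u" 2] by simp
    then have "c = 0" using False by (simp add: norm_scaleC)
    then show ?thesis using False by (simp add: c_def)
  qed simp
  with yM that show thesis by blast
qed

text \<open>A nonzero vector \<open>w\<close> orthogonal to the kernel of \<open>f\<close>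
  represents \<open>f\<close> up to a scalar, because
  \<open>f w *\<^sub>C x - f x *\<^sub>C w\<close> lies in the kernel.\<close>

lemma riesz_representation:
  fixes f :: "'a::complex_hilbert \<Rightarrow> complex"
  assumes bl: "bounded_linear f" and lin: "\<And>c x. f (c *\<^sub>C x) = c * f x"
  obtains y where "\<And>x. f x = cinner x y"
proof (cases "\<forall>x. f x = 0")
  case True
  then show thesis using that[of 0] by simp
next
  case False
  interpret f: bounded_linear f by fact
  define M where "M = {x. f x = 0}"
  have sub: "complex_vector.subspace M"
    by (auto simp: M_def complex_vector.subspace_def f.add f.zero lin)
  have "M = f -` {0}" by (auto simp: M_def)
  then have cl: "closed M"
    by (metis closed_singleton continuous_closed_vimage linear_continuous_at bl)
  obtain x0 where x0: "f x0 \<noteq> 0" using False by blast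
  obtain y where y: "y \<in> M" and orth: "\<And>z. z \<in> M \<Longrightarrow> cinner (x0 - y) z = 0"
    using orthogonal_decomposition[OF sub cl] by blast
  define w where "w = x0 - y"
  have fw: "f w = f x0" using y by (simp add: w_def f.diff M_def)
  have w0: "w \<noteq> 0" using fw x0 f.zero by force
  show thesis
  proof (rule that)
    fix x
    define c where "c = cnj (f w) / complex_of_real ((norm w)\<^sup>2)"
    have "f w *\<^sub>C x - f x *\<^sub>C w \<in> M" by (simp add: M_def f.diff lin)
    then have "cinner w (f w *\<^sub>C x - f x *\<^sub>C w) = 0" unfolding w_def by (rule orth)
    then have "cinner (f w *\<^sub>C x - f x *\<^sub>C w) w = 0" by (subst cinner_zero_commute)
    then have "f w * cinner x w = f x * complex_of_real ((norm w)\<^sup>2)"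
      by (simp add: cinner_simps cinner_self)
    then show "f x = cinner x (c *\<^sub>C w)"
      using w0 by (simp add: cinner_scaleC_right c_def field_simps)
  qed
qed

subsection \<open>Adjoints and compact operators\<close>

lemma bounded_operator_linear:
  assumes "bounded_operator T"
  shows "T (x + y) = T x + T y" "T (x - y) = T x - T y" "T (c *\<^sub>C x) = c *\<^sub>C T x" "T 0 = 0"
    "T (r *\<^sub>R x) = r *\<^sub>R T x" "T (- x) = - T x" "T (sum f S) = (\<Sum>i\<in>S. T (f i))"
proof -
  interpret bounded_linear T using assms bounded_operator_def by blast
  show "T (x + y) = T x + T y" "T (x - y) = T x - T y" "T 0 = 0"
    "T (r *\<^sub>R x) = r *\<^sub>R T x" "T (- x) = - T x" "T (sum f S) = (\<Sum>i\<in>S. T (f i))"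
    by (fact add diff zero scaleR neg sum)+
  show "T (c *\<^sub>C x) = c *\<^sub>C T x" using assms bounded_operator_def by blast
qed

lemma bounded_operator_bounded_linear: "bounded_operator T \<Longrightarrow> bounded_linear T"
  by (simp add: bounded_operator_def)

lemma bounded_operator_add:
  assumes "bounded_operator S" "bounded_operator T"
  shows "bounded_operator (\<lambda>x. S x + T x)"
  using assms by (auto simp: bounded_operator_def scaleC_add_right intro: bounded_linear_add)

lemma bounded_operator_comp:
  assumes "bounded_operator S" "bounded_operator T"
  shows "bounded_operator (\<lambda>x. S (T x))"
  using assms bounded_linear_compose[of S T] by (auto simp: bounded_operator_def)

lemma bounded_operator_minus: "bounded_operator S \<Longrightarrow> bounded_operator (\<lambda>x. - S x)"
  by (auto simp: bounded_operator_def intro: bounded_linear_minus)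

lemma bounded_operator_diff:
  assumes "bounded_operator S" "bounded_operator T"
  shows "bounded_operator (\<lambda>x. S x - T x)"
  using bounded_operator_add[OF assms(1) bounded_operator_minus[OF assms(2)]] by simp

lemma cinner_adjoint:
  fixes T :: "'a::complex_hilbert \<Rightarrow> 'a"
  assumes T: "bounded_operator T"
  shows "cinner (T x) y = cinner x (hilbert_adjoint T y)"
proof -
  have "\<exists>z. \<forall>x. cinner (T x) y = cinner x z" for y
  proof -
    have "bounded_linear (\<lambda>x. cinner (T x) y)"
      using bounded_linear_compose[OF bounded_linear_cinner_left bounded_operator_bounded_linear[OF T]] .
    then obtain z where "\<And>x. cinner (T x) y = cinner x z"
      by (rule riesz_representation) (auto simp: bounded_operator_linear[OF T] cinner_scaleC_left)
    then show ?thesis by blast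
  qed
  then obtain S where S: "\<And>x y. cinner (T x) y = cinner x (S y)" by metis
  have "hilbert_adjoint T = S"
    unfolding hilbert_adjoint_def
  proof (rule the_equality)
    fix S' assume S': "\<forall>x y. cinner (T x) y = cinner x (S' y)"
    show "S' = S"
      by (rule ext, rule cinner_ext) (metis S S' cinner_commute)
  qed (use S in blast)
  then show ?thesis using S by simp
qed

lemma cinner_adjoint_left:
  assumes T: "bounded_operator T"
  shows "cinner (hilbert_adjoint T x) y = cinner x (T y)"
  by (metis cinner_adjoint[OF T] cinner_commute)

lemma adjoint_eqI:
  fixes T :: "'a::complex_hilbert \<Rightarrow> 'a"
  assumes T: "bounded_operator T" and S: "\<And>x y. cinner (T x) y = cinner x (S y)"
  shows "hilbert_adjoint T = S"
  by (rule ext, rule cinner_ext) (metis S cinner_adjoint[OF T] cinner_commute)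

lemma bounded_operator_adjoint:
  fixes T :: "'a::complex_hilbert \<Rightarrow> 'a"
  assumes T: "bounded_operator T"
  shows "bounded_operator (hilbert_adjoint T)"
proof -
  let ?S = "hilbert_adjoint T"
  note adj = cinner_adjoint_left[OF T]
  obtain K where K: "\<And>x. norm (T x) \<le> norm x * K"
    using bounded_linear.bounded[OF bounded_operator_bounded_linear[OF T]] by blast
  have clin: "?S (c *\<^sub>C x) = c *\<^sub>C ?S x" for c x
    by (rule cinner_ext) (simp add: adj cinner_simps)
  have "norm (?S x) \<le> norm x * K" for x
  proof (cases "?S x = 0")
    case True
    then show ?thesis using order_trans[OF norm_ge_zero K[of x]] by simp
  next
    case False
    have "(norm (?S x))\<^sup>2 = cmod (cinner (?S x) (?S x))" by (simp add: cinner_self norm_power)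
    also have "\<dots> = cmod (cinner x (T (?S x)))" by (simp add: adj)
    also have "\<dots> \<le> norm x * norm (T (?S x))" by (rule norm_cinner_le)
    also have "\<dots> \<le> norm x * (norm (?S x) * K)" by (intro mult_left_mono K) simp
    finally have "norm (?S x) * norm (?S x) \<le> norm (?S x) * (norm x * K)"
      by (simp add: power2_eq_square mult_ac)
    then show ?thesis using False by (simp add: mult_le_cancel_left)
  qed
  moreover have "?S (x + y) = ?S x + ?S y" for x y
    by (rule cinner_ext) (simp add: adj cinner_simps)
  ultimately have "bounded_linear ?S"
    by (intro bounded_linear_intro[where K = K]) (simp_all add: scaleR_scaleC clin)
  then show ?thesis using clin by (simp add: bounded_operator_def)
qed

lemma adjoint_adjoint:
  assumes T: "bounded_operator T"
  shows "hilbert_adjoint (hilbert_adjoint T) = T"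
  by (rule adjoint_eqI[OF bounded_operator_adjoint[OF T]]) (rule cinner_adjoint_left[OF T])

section \<open>Compactness through convergent subsequences\<close>

lemma compact_operator_bounded: "compact_operator T \<Longrightarrow> bounded_operator T"
  by (simp add: compact_operator_def)

lemma compact_operator_subseq:
  assumes T: "compact_operator T" and x: "bounded (range x)"
  obtains l r where "strict_mono (r :: nat \<Rightarrow> nat)" "(\<lambda>n. T (x (r n))) \<longlonglongrightarrow> l"
proof -
  have "compact (closure (T ` range x))" using T x by (simp add: compact_operator_def)
  then have "seq_compact (closure (T ` range x))" by (rule compact_imp_seq_compact)
  moreover have "\<forall>n. T (x n) \<in> closure (T ` range x)"
    using closure_subset[of "T ` range x"] by blast
  ultimately obtain l r where "strict_mono r" "((\<lambda>n. T (x n)) \<circ> r) \<longlonglongrightarrow> l"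
    unfolding seq_compact_def by (metis (no_types, lifting))
  then show thesis using that by (simp add: o_def)
qed

text \<open>Points of the closure are approximated by images \<open>T (y n)\<close> with errors
  tending to 0, so it is enough to extract subsequences from images.\<close>

lemma compact_operatorI:
  assumes T: "bounded_operator T"
    and sub: "\<And>x. bounded (range x) \<Longrightarrow> \<exists>l r. strict_mono (r :: nat \<Rightarrow> nat) \<and> (\<lambda>n. T (x (r n))) \<longlonglongrightarrow> l"
  shows "compact_operator T"
  unfolding compact_operator_def
proof (intro conjI allI impI T)
  fix S :: "'a set" assume S: "bounded S"
  show "compact (closure (T ` S))"
    unfolding compact_eq_seq_compact_metric
    unfolding seq_compact_def
  proof (intro allI impI)
    fix f :: "nat \<Rightarrow> 'a" assume f: "\<forall>n. f n \<in> closure (T ` S)"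
    have "\<exists>y\<in>S. dist (T y) (f n) < 1 / real (Suc n)" for n
      using f[rule_format, of n] closure_approachable[of "f n" "T ` S"] by force
    then obtain y where yS: "\<And>n. y n \<in> S" and yf: "\<And>n. dist (T (y n)) (f n) < 1 / real (Suc n)"
      by metis
    have "bounded (range y)" using S yS by (metis bounded_subset image_subsetI)
    then obtain l r where r: "strict_mono (r :: nat \<Rightarrow> nat)" and l: "(\<lambda>n. T (y (r n))) \<longlonglongrightarrow> l"
      using sub by blast
    have d0: "(\<lambda>n. f n - T (y n)) \<longlonglongrightarrow> 0"
    proof (rule Lim_null_comparison)
      show "\<forall>\<^sub>F n in sequentially. norm (f n - T (y n)) \<le> 1 / real (Suc n)"
        using yf by (auto intro!: always_eventually simp: dist_norm norm_minus_commute less_imp_le)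
      show "(\<lambda>n. 1 / real (Suc n)) \<longlonglongrightarrow> 0"
        using LIMSEQ_inverse_real_of_nat by (simp add: inverse_eq_divide)
    qed
    have "(\<lambda>n. (f (r n) - T (y (r n))) + T (y (r n))) \<longlonglongrightarrow> 0 + l"
      using LIMSEQ_subseq_LIMSEQ[OF d0 r] l by (intro tendsto_add) (simp_all add: o_def)
    then have fl: "(f \<circ> r) \<longlonglongrightarrow> l" by (simp add: o_def)
    moreover have "l \<in> closure (T ` S)"
      using fl f by (metis closed_closure closed_sequentially comp_apply)
    ultimately show "\<exists>l\<in>closure (T ` S). \<exists>r. strict_mono r \<and> (f \<circ> r) \<longlonglongrightarrow> l" using r by blast
  qed
qed

lemma compact_operator_add:
  assumes S: "compact_operator S" and T: "compact_operator T"
  shows "compact_operator (\<lambda>x. S x + T x)"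
proof (rule compact_operatorI)
  show "bounded_operator (\<lambda>x. S x + T x)"
    using assms by (simp add: bounded_operator_add compact_operator_bounded)
  fix x :: "nat \<Rightarrow> 'a" assume x: "bounded (range x)"
  obtain r l where r: "strict_mono (r :: nat \<Rightarrow> nat)" and l: "(\<lambda>n. S (x (r n))) \<longlonglongrightarrow> l"
    using compact_operator_subseq[OF S x] by metis
  have "bounded (range (\<lambda>n. x (r n)))" using x by (rule bounded_subset) auto
  from compact_operator_subseq[OF T this]
  obtain q m where q: "strict_mono (q :: nat \<Rightarrow> nat)" and m: "(\<lambda>n. T (x (r (q n)))) \<longlonglongrightarrow> m" .
  have "(\<lambda>n. S (x (r (q n)))) \<longlonglongrightarrow> l" using LIMSEQ_subseq_LIMSEQ[OF l q] by (simp add: o_def)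
  from tendsto_add[OF this m]
  show "\<exists>l r. strict_mono (r :: nat \<Rightarrow> nat) \<and> (\<lambda>n. S (x (r n)) + T (x (r n))) \<longlonglongrightarrow> l"
    using strict_mono_o[OF r q] by (intro exI[of _ "l + m"] exI[of _ "r \<circ> q"]) simp
qed

lemma compact_operator_comp_left:
  assumes S: "bounded_operator S" and T: "compact_operator T"
  shows "compact_operator (\<lambda>x. S (T x))"
proof (rule compact_operatorI)
  show "bounded_operator (\<lambda>x. S (T x))"
    using assms by (simp add: bounded_operator_comp compact_operator_bounded)
  fix x :: "nat \<Rightarrow> 'a" assume x: "bounded (range x)"
  obtain r l where r: "strict_mono (r :: nat \<Rightarrow> nat)" and l: "(\<lambda>n. T (x (r n))) \<longlonglongrightarrow> l"
    using compact_operator_subseq[OF T x] by metis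
  from bounded_linear.tendsto[OF bounded_operator_bounded_linear[OF S] l] r
  show "\<exists>l r. strict_mono (r :: nat \<Rightarrow> nat) \<and> (\<lambda>n. S (T (x (r n)))) \<longlonglongrightarrow> l" by blast
qed

lemma compact_operator_scaleC:
  assumes "compact_operator T"
  shows "compact_operator (\<lambda>x. c *\<^sub>C T x)"
proof -
  have "bounded_operator (\<lambda>x::'a. c *\<^sub>C x)"
    by (simp add: bounded_operator_def bounded_linear_scaleC scaleC_scaleC mult.commute)
  from compact_operator_comp_left[OF this assms] show ?thesis .
qed

lemma scaleC_minus1: "(- 1) *\<^sub>C x = - x" for x :: "'a::complex_vector"
  using complex_vector.scale_minus_left[of 1 x] by (simp add: scaleC_one)

lemma compact_operator_diff:
  assumes "compact_operator S" "compact_operator T"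
  shows "compact_operator (\<lambda>x. S x - T x)"
  using compact_operator_add[OF assms(1) compact_operator_scaleC[OF assms(2), of "-1"]]
  by (simp add: scaleC_minus1)

text \<open>Schauder's theorem. The estimate \<open>key\<close> bounds differences of adjoint images
  by differences of their images under \<open>T\<close>; convergence of the latter along a
  subsequence makes the former Cauchy.\<close>

lemma compact_operator_adjoint:
  fixes T :: "'a::complex_hilbert \<Rightarrow> 'a"
  assumes T: "compact_operator T"
  shows "compact_operator (hilbert_adjoint T)"
proof (rule compact_operatorI)
  note bT = compact_operator_bounded[OF T]
  let ?S = "hilbert_adjoint T"
  show bS: "bounded_operator ?S" by (rule bounded_operator_adjoint[OF bT])
  fix x :: "nat \<Rightarrow> 'a" assume x: "bounded (range x)"
  then obtain K where K: "\<And>n. norm (x n) \<le> K" unfolding bounded_iff by auto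
  have "bounded (?S ` range x)"
    using bounded_linear_image[OF x bounded_operator_bounded_linear[OF bS]] .
  then have "bounded (range (\<lambda>n. ?S (x n)))" by (simp add: image_image)
  from compact_operator_subseq[OF T this]
  obtain r l where r: "strict_mono (r :: nat \<Rightarrow> nat)" and l: "(\<lambda>n. T (?S (x (r n)))) \<longlonglongrightarrow> l" .
  have key: "(norm (?S u - ?S v))\<^sup>2 \<le> norm (T (?S u) - T (?S v)) * norm (u - v)" for u v
  proof -
    have "(norm (?S (u - v)))\<^sup>2 = cmod (cinner (?S (u - v)) (?S (u - v)))" by (simp add: cinner_self norm_power)
    also have "\<dots> = cmod (cinner (T (?S (u - v))) (u - v))" by (simp add: cinner_adjoint[OF bT])
    also have "\<dots> \<le> norm (T (?S (u - v))) * norm (u - v)" by (rule norm_cinner_le)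
    finally show ?thesis by (simp add: bounded_operator_linear[OF bS] bounded_operator_linear[OF bT])
  qed
  have "Cauchy (\<lambda>n. ?S (x (r n)))"
  proof (rule metric_CauchyI)
    fix e :: real assume e: "e > 0"
    have K0: "K \<ge> 0" using K[of 0] norm_ge_zero[of "x 0"] by linarith
    \<comment> \<open>The added 1 keeps the denominator positive when \<open>K = 0\<close>.\<close>
    have "e\<^sup>2 / (2 * K + 1) > 0" using e K0 by (simp add: divide_pos_pos)
    then obtain N where N: "\<And>m n. m \<ge> N \<Longrightarrow> n \<ge> N \<Longrightarrow>
        dist (T (?S (x (r m)))) (T (?S (x (r n)))) < e\<^sup>2 / (2 * K + 1)"
      using metric_CauchyD[OF LIMSEQ_imp_Cauchy[OF l]] by blast
    have "dist (?S (x (r m))) (?S (x (r n))) < e" if mn: "m \<ge> N" "n \<ge> N" for m n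
    proof -
      have "norm (x (r m) - x (r n)) \<le> 2 * K + 1"
        using norm_triangle_ineq4[of "x (r m)" "x (r n)"] K[of "r m"] K[of "r n"] by linarith
      then have "(norm (?S (x (r m)) - ?S (x (r n))))\<^sup>2
          \<le> norm (T (?S (x (r m))) - T (?S (x (r n)))) * (2 * K + 1)"
        using key order_trans mult_left_mono norm_ge_zero by meson
      also have "\<dots> < e\<^sup>2"
        using N[OF mn] K0 by (simp add: dist_norm pos_less_divide_eq)
      finally show ?thesis using e by (simp add: dist_norm power_less_imp_less_base)
    qed
    then show "\<exists>N. \<forall>m\<ge>N. \<forall>n\<ge>N. dist (?S (x (r m))) (?S (x (r n))) < e" by blast
  qed
  then show "\<exists>l r. strict_mono (r :: nat \<Rightarrow> nat) \<and> (\<lambda>n. ?S (x (r n))) \<longlonglongrightarrow> l"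
    using r Cauchy_convergent convergent_def by metis
qed

subsection \<open>Orthonormal sets\<close>

definition orthonormal_set :: "'a::complex_inner set \<Rightarrow> bool" where
  "orthonormal_set E \<longleftrightarrow> (\<forall>x\<in>E. \<forall>y\<in>E. cinner x y = (if x = y then 1 else 0))"

text \<open>A trivial orthogonal complement instead of a dense span: this is what a maximality
  argument delivers. Together with \<open>orthonormal_set\<close> it says that \<open>E\<close> is
  an orthonormal basis, of any cardinality.\<close>

definition total_set :: "'a::complex_inner set \<Rightarrow> bool" where
  "total_set E \<longleftrightarrow> (\<forall>x. (\<forall>e\<in>E. cinner x e = 0) \<longrightarrow> x = 0)"

lemma total_setD: "total_set E \<Longrightarrow> (\<And>e. e \<in> E \<Longrightarrow> cinner x e = 0) \<Longrightarrow> x = 0"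
  by (simp add: total_set_def)

lemma orthonormal_setD:
  assumes "orthonormal_set E" "x \<in> E" "y \<in> E"
  shows "cinner x y = (if x = y then 1 else 0)"
  using assms by (simp add: orthonormal_set_def)

lemma orthonormal_set_subset: "orthonormal_set E \<Longrightarrow> F \<subseteq> E \<Longrightarrow> orthonormal_set F"
  unfolding orthonormal_set_def by blast

lemma norm_one_of_cinner_self: "cinner x x = 1 \<Longrightarrow> norm x = 1" for x :: "'a::complex_inner"
  by (simp add: norm_eq_sqrt_inner inner_eq_Re_cinner)

lemma orthonormal_set_norm: "orthonormal_set E \<Longrightarrow> x \<in> E \<Longrightarrow> norm x = 1"
  using orthonormal_setD[of E x x] by (simp add: norm_one_of_cinner_self)

lemma cinner_orthonormal_sum:
  assumes "orthonormal_set E" "F \<subseteq> E" "finite F" "e \<in> E"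
  shows "cinner (\<Sum>f\<in>F. c f *\<^sub>C f) e = (if e \<in> F then c e else 0)"
proof -
  have "cinner (\<Sum>f\<in>F. c f *\<^sub>C f) e = (\<Sum>f\<in>F. if f = e then c e else 0)"
    unfolding cinner_sum_left
    by (rule sum.cong) (use assms orthonormal_setD[OF assms(1)] in \<open>auto simp: cinner_simps\<close>)
  then show ?thesis using assms(3) by (simp add: sum.delta)
qed

lemma cinner_orthonormal_sums:
  assumes "orthonormal_set F" "finite F"
  shows "cinner (\<Sum>f\<in>F. c f *\<^sub>C f) (\<Sum>f\<in>F. d f *\<^sub>C f) = (\<Sum>f\<in>F. c f * cnj (d f))"
proof -
  have "cinner (\<Sum>f\<in>F. c f *\<^sub>C f) (d e *\<^sub>C e) = c e * cnj (d e)" if "e \<in> F" for e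
    using cinner_orthonormal_sum[OF assms(1) subset_refl assms(2) that, of c] that
    by (simp add: cinner_scaleC_right)
  then show ?thesis by (simp add: cinner_sum_right)
qed

lemma norm_orthonormal_sum:
  assumes "orthonormal_set F" "finite F"
  shows "(norm (\<Sum>f\<in>F. c f *\<^sub>C f))\<^sup>2 = (\<Sum>f\<in>F. (cmod (c f))\<^sup>2)"
proof -
  have "complex_of_real ((norm (\<Sum>f\<in>F. c f *\<^sub>C f))\<^sup>2) = complex_of_real (\<Sum>f\<in>F. (cmod (c f))\<^sup>2)"
    unfolding cinner_self[symmetric] cinner_orthonormal_sums[OF assms]
    by (simp add: complex_norm_square[symmetric])
  then show ?thesis using of_real_eq_iff by blast
qed

lemma norm_orthonormal_remainder:
  assumes F: "orthonormal_set F" "finite F"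
  shows "(norm x)\<^sup>2 = (norm (x - (\<Sum>f\<in>F. cinner x f *\<^sub>C f)))\<^sup>2 + (\<Sum>f\<in>F. (cmod (cinner x f))\<^sup>2)"
proof -
  let ?p = "\<Sum>f\<in>F. cinner x f *\<^sub>C f"
  have orth: "cinner (x - ?p) f = 0" if "f \<in> F" for f
    using cinner_orthonormal_sum[OF F(1) subset_refl F(2) that] that by (simp add: cinner_diff_left)
  have "cinner (x - ?p) ?p = 0"
    by (simp add: cinner_sum_right cinner_scaleC_right orth)
  from norm_add_pythagoras[OF this] show ?thesis
    by (simp add: norm_orthonormal_sum[OF F])
qed

lemma bessel_inequality:
  assumes "orthonormal_set F" "finite F"
  shows "(\<Sum>f\<in>F. (cmod (cinner x f))\<^sup>2) \<le> (norm x)\<^sup>2"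
  using norm_orthonormal_remainder[OF assms, of x] by simp

lemma orthonormal_remainder_minimal:
  assumes F: "orthonormal_set F" "finite F"
  shows "norm (x - (\<Sum>f\<in>F. cinner x f *\<^sub>C f)) \<le> norm (x - (\<Sum>f\<in>F. c f *\<^sub>C f))"
proof -
  let ?p = "\<Sum>f\<in>F. cinner x f *\<^sub>C f"
  have orth: "cinner (x - ?p) f = 0" if "f \<in> F" for f
    using cinner_orthonormal_sum[OF F(1) subset_refl F(2) that] that by (simp add: cinner_diff_left)
  have "cinner (x - ?p) (?p - (\<Sum>f\<in>F. c f *\<^sub>C f)) = 0"
    by (simp add: cinner_sum_right cinner_diff_right cinner_scaleC_right orth)
  from norm_add_pythagoras[OF this]
  have "(norm (x - ?p))\<^sup>2 \<le> (norm (x - (\<Sum>f\<in>F. c f *\<^sub>C f)))\<^sup>2" by simp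
  then show ?thesis by (simp add: power2_le_iff_abs_le)
qed

lemma closure_complex_subspace:
  fixes M :: "'a::complex_inner set"
  assumes M: "complex_vector.subspace M"
  shows "complex_vector.subspace (closure M)"
  unfolding complex_vector.subspace_def
proof (intro conjI ballI allI)
  show "0 \<in> closure M"
    using complex_vector.subspace_0[OF M] closure_subset by blast
  fix x y assume xy: "x \<in> closure M" "y \<in> closure M"
  obtain a where a: "\<And>n. a n \<in> M" "a \<longlonglongrightarrow> x" using xy(1) closure_sequential by metis
  obtain b where b: "\<And>n. b n \<in> M" "b \<longlonglongrightarrow> y" using xy(2) closure_sequential by metis
  have "(\<lambda>n. a n + b n) \<longlonglongrightarrow> x + y" using a b by (intro tendsto_intros)
  moreover have "a n + b n \<in> M" for n using a b complex_vector.subspace_add[OF M] by blast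
  ultimately show "x + y \<in> closure M"
    unfolding closure_sequential by (intro exI[of _ "\<lambda>n. a n + b n"]) simp
next
  fix c x assume x: "x \<in> closure M"
  obtain a where a: "\<And>n. a n \<in> M" "a \<longlonglongrightarrow> x" using x closure_sequential by metis
  have "(\<lambda>n. c *\<^sub>C a n) \<longlonglongrightarrow> c *\<^sub>C x" by (rule bounded_linear.tendsto[OF bounded_linear_scaleC a(2)])
  moreover have "c *\<^sub>C a n \<in> M" for n using a complex_vector.subspace_scale[OF M] by blast
  ultimately show "c *\<^sub>C x \<in> closure M"
    unfolding closure_sequential by (intro exI[of _ "\<lambda>n. c *\<^sub>C a n"]) simp
qed

section \<open>Expansions in an orthonormal basis\<close>

lemma total_set_closure_span:
  fixes E :: "'a::complex_hilbert set"
  assumes "total_set E"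
  shows "x \<in> closure (complex_vector.span E)"
proof -
  let ?M = "closure (complex_vector.span E)"
  obtain y where y: "y \<in> ?M" and orth: "\<And>z. z \<in> ?M \<Longrightarrow> cinner (x - y) z = 0"
    using orthogonal_decomposition[OF closure_complex_subspace[OF complex_vector.subspace_span] closed_closure]
    by blast
  have "x - y = 0"
  proof (rule total_setD[OF assms])
    fix e assume "e \<in> E"
    then have "e \<in> ?M" using complex_vector.span_base[of e E] closure_subset by blast
    then show "cinner (x - y) e = 0" by (rule orth)
  qed
  then show ?thesis using y by simp
qed

text \<open>Density gives some combination over a finite \<open>F\<close> close to \<open>x\<close>.
  Over any larger \<open>G\<close> the coefficients \<open>cinner x f\<close> are the best choice,
  so the bound persists. This is convergence along finite subsets, as \<open>has_sum\<close>
  requires for an \<open>E\<close> that may be uncountable.\<close>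

lemma orthonormal_expansion_approx:
  fixes E :: "'a::complex_hilbert set"
  assumes E: "orthonormal_set E" "total_set E" and e: "e > 0"
  obtains F where "finite F" "F \<subseteq> E"
    "\<And>G. finite G \<Longrightarrow> F \<subseteq> G \<Longrightarrow> G \<subseteq> E \<Longrightarrow> norm (x - (\<Sum>f\<in>G. cinner x f *\<^sub>C f)) < e"
proof -
  obtain y where y: "y \<in> complex_vector.span E" and xy: "dist y x < e"
    using total_set_closure_span[OF E(2), of x] e unfolding closure_approachable by blast
  from y obtain F c where F: "finite F" "F \<subseteq> E" and yF: "y = (\<Sum>f\<in>F. c f *\<^sub>C f)"
    unfolding complex_vector.span_explicit by blast
  show thesis
  proof (rule that[OF F])
    fix G assume G: "finite G" "F \<subseteq> G" "G \<subseteq> E"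
    have "(\<Sum>f\<in>G. (if f \<in> F then c f else 0) *\<^sub>C f) = y"
      unfolding yF by (rule sum.mono_neutral_cong_right) (use G in auto)
    then have "norm (x - (\<Sum>f\<in>G. cinner x f *\<^sub>C f)) \<le> norm (x - y)"
      using orthonormal_remainder_minimal[OF orthonormal_set_subset[OF E(1) G(3)] G(1), of x
          "\<lambda>f. if f \<in> F then c f else 0"] by simp
    also have "\<dots> < e" using xy by (simp add: dist_norm norm_minus_commute)
    finally show "norm (x - (\<Sum>f\<in>G. cinner x f *\<^sub>C f)) < e" .
  qed
qed

lemma parseval_cinner:
  fixes E :: "'a::complex_hilbert set"
  assumes E: "orthonormal_set E" "total_set E"
  shows "((\<lambda>e. cinner u e * cnj (cinner x e)) has_sum cinner u x) E"
  unfolding has_sum_def tendsto_iff eventually_finite_subsets_at_top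
proof (intro allI impI)
  fix r :: real assume r: "0 < r"
  then have "r / (norm u + 1) > 0" by (simp add: add_nonneg_pos)
  then obtain F where F: "finite F" "F \<subseteq> E" and close:
    "\<And>G. finite G \<Longrightarrow> F \<subseteq> G \<Longrightarrow> G \<subseteq> E \<Longrightarrow> norm (x - (\<Sum>f\<in>G. cinner x f *\<^sub>C f)) < r / (norm u + 1)"
    by (rule orthonormal_expansion_approx[OF E]) blast
  have "dist (\<Sum>e\<in>G. cinner u e * cnj (cinner x e)) (cinner u x) < r"
    if G: "finite G" "F \<subseteq> G" "G \<subseteq> E" for G
  proof -
    have "cinner u x - (\<Sum>e\<in>G. cinner u e * cnj (cinner x e)) = cinner u (x - (\<Sum>f\<in>G. cinner x f *\<^sub>C f))"
      by (simp add: cinner_diff_right cinner_sum_right cinner_scaleC_right mult.commute)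
    then have "dist (\<Sum>e\<in>G. cinner u e * cnj (cinner x e)) (cinner u x)
        \<le> norm u * norm (x - (\<Sum>f\<in>G. cinner x f *\<^sub>C f))"
      by (simp add: dist_norm norm_minus_commute norm_cinner_le)
    also have "\<dots> \<le> (norm u + 1) * norm (x - (\<Sum>f\<in>G. cinner x f *\<^sub>C f))"
      by (intro mult_right_mono) simp_all
    also have "\<dots> < r"
      using close[OF G] by (simp add: pos_less_divide_eq add_nonneg_pos mult.commute)
    finally show ?thesis .
  qed
  then show "\<exists>X. finite X \<and> X \<subseteq> E \<and> (\<forall>Y. finite Y \<and> X \<subseteq> Y \<and> Y \<subseteq> E \<longrightarrow>
      dist (\<Sum>e\<in>Y. cinner u e * cnj (cinner x e)) (cinner u x) < r)"
    using F by blast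
qed

lemma parseval_norm:
  fixes E :: "'a::complex_hilbert set"
  assumes E: "orthonormal_set E" "total_set E"
  shows "((\<lambda>e. (cmod (cinner x e))\<^sup>2) has_sum (norm x)\<^sup>2) E"
  using has_sum_Re[OF parseval_cinner[OF E, of x x]]
  by (simp add: complex_norm_square[symmetric] cinner_self)

subsection \<open>Spectral theorem for commuting compact self-adjoint operators\<close>

definition self_adjoint :: "('a::complex_inner \<Rightarrow> 'a) \<Rightarrow> bool" where
  "self_adjoint B \<longleftrightarrow> (\<forall>x y. cinner (B x) y = cinner x (B y))"

lemma self_adjointD: "self_adjoint B \<Longrightarrow> cinner (B x) y = cinner x (B y)"
  by (simp add: self_adjoint_def)

text \<open>
  A sequence of unit vectors \<open>x n\<close> with \<open>norm (B (x n))\<close> tending to the norm \<open>s\<close> of the restriction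
  of \<open>B\<close> to \<open>M\<close> satisfies \<open>B (B (x n)) - s\<^sup>2 x n \<rightarrow> 0\<close>, so compactness yields a fixed vector of
  \<open>s\<^sup>-\<^sup>2 B\<^sup>2\<close>; it then remains to factor \<open>B\<^sup>2 - s\<^sup>2\<close>.
\<close>
lemma compact_self_adjoint_eigenvector:
  fixes B :: "'a::complex_hilbert \<Rightarrow> 'a"
  assumes B: "compact_operator B" "self_adjoint B"
    and M: "complex_vector.subspace M" "closed M" and inv: "\<And>x. x \<in> M \<Longrightarrow> B x \<in> M"
    and nz: "x0 \<in> M" "B x0 \<noteq> 0"
  obtains x c where "x \<in> M" "x \<noteq> 0" "B x = c *\<^sub>C x"
proof -
  note lin = bounded_operator_linear[OF compact_operator_bounded[OF B(1)]]
  note msub = complex_vector.subspace_add[OF M(1)] complex_vector.subspace_scale[OF M(1)]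
    complex_vector.subspace_diff[OF M(1)]
  define U where "U = {x\<in>M. norm x = 1}"
  define s where "s = (SUP x\<in>U. norm (B x))"
  obtain K where K: "\<And>x. norm (B x) \<le> norm x * K"
    using bounded_linear.bounded[OF bounded_operator_bounded_linear[OF compact_operator_bounded[OF B(1)]]]
    by blast
  have "norm (B x) \<le> K" if "x \<in> U" for x
    using K[of x] that by (simp add: U_def)
  then have bdd: "bdd_above ((\<lambda>x. norm (B x)) ` U)"
    by (rule bdd_aboveI2)
  have le_s: "norm (B x) \<le> s" if "x \<in> U" for x
    unfolding s_def using that bdd by (rule cSUP_upper)
  have x0: "x0 \<noteq> 0" using nz lin(4) by auto
  define u0 where "u0 = (1 / norm x0) *\<^sub>R x0"
  have u0: "u0 \<in> U" "B u0 \<noteq> 0"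
    using x0 nz msub(2)[OF nz(1), of "complex_of_real (1 / norm x0)"]
    by (auto simp: U_def u0_def lin scaleR_scaleC[symmetric] simp del: of_real_divide)
  then have Une: "U \<noteq> {}" by blast
  have s0: "s > 0" using le_s[OF u0(1)] u0(2) by (meson less_le_trans zero_less_norm_iff)
  have sle: "norm (B x) \<le> s * norm x" if "x \<in> M" for x
  proof (cases "x = 0")
    case False
    have "(1 / norm x) *\<^sub>R x \<in> U"
      using False msub(2)[OF that, of "complex_of_real (1 / norm x)"]
      by (auto simp: U_def scaleR_scaleC[symmetric] simp del: of_real_divide)
    from le_s[OF this] have "norm (B x) / norm x \<le> s" by (simp add: lin)
    then show ?thesis using False by (simp add: pos_divide_le_eq)
  qed (simp add: lin)
  have "\<exists>x\<in>U. s - 1 / real (Suc n) < norm (B x)" for n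
    using less_cSUP_iff[OF Une bdd, of "s - 1 / real (Suc n)"] s_def
    by (metis diff_less_eq less_add_same_cancel1 of_nat_0_less_iff zero_less_Suc zero_less_divide_1_iff)
  then obtain x where xU: "\<And>n. x n \<in> U" and xs: "\<And>n. s - 1 / real (Suc n) < norm (B (x n))"
    by metis
  have xM: "x n \<in> M" and x1: "norm (x n) = 1" for n using xU[of n] by (auto simp: U_def)
  have lim: "(\<lambda>n. norm (B (x n))) \<longlonglongrightarrow> s"
  proof (rule tendsto_sandwich[of "\<lambda>n. s - 1 / real (Suc n)" _ _ "\<lambda>_. s"])
    show "(\<lambda>n. s - 1 / real (Suc n)) \<longlonglongrightarrow> s"
      using tendsto_diff[OF tendsto_const[of s] LIMSEQ_inverse_real_of_nat] by (simp add: inverse_eq_divide)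
    show "\<forall>\<^sub>F n in sequentially. s - 1 / real (Suc n) \<le> norm (B (x n))"
      by (intro always_eventually allI less_imp_le xs)
  qed (auto intro!: always_eventually le_s xU)
  define d where "d n = B (B (x n)) - s\<^sup>2 *\<^sub>R x n" for n
  \<comment> \<open>Self-adjointness turns the cross term into the square of
    \<open>norm (B (x n))\<close>, and \<open>norm (B (B (x n)))\<close> is at most
    \<open>s * norm (B (x n))\<close> because \<open>B\<close> preserves \<open>M\<close>.\<close>
  have d_le: "(norm (d n))\<^sup>2 \<le> s\<^sup>2 * (s\<^sup>2 - (norm (B (x n)))\<^sup>2)" for n
  proof -
    have "inner (B (B (x n))) (x n) = (norm (B (x n)))\<^sup>2"
      using self_adjointD[OF B(2), of "B (x n)" "x n"]
      by (simp add: inner_eq_Re_cinner cinner_self)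
    moreover have "(norm (d n))\<^sup>2 = (norm (B (B (x n))))\<^sup>2
        - 2 * s\<^sup>2 * inner (B (B (x n))) (x n) + s\<^sup>2 * s\<^sup>2 * (norm (x n))\<^sup>2"
      unfolding d_def power2_norm_eq_inner inner_diff_left inner_diff_right inner_scaleR_left
        inner_scaleR_right inner_commute[of "x n" "B (B (x n))"]
      by (simp add: algebra_simps)
    moreover have "(norm (B (B (x n))))\<^sup>2 \<le> s\<^sup>2 * (norm (B (x n)))\<^sup>2"
      using power_mono[OF sle[OF inv[OF xM[of n]]] norm_ge_zero, of 2] by (simp add: power_mult_distrib)
    ultimately show ?thesis using x1[of n] by (simp add: right_diff_distrib)
  qed
  have "(\<lambda>n. s\<^sup>2 * (s\<^sup>2 - (norm (B (x n)))\<^sup>2)) \<longlonglongrightarrow> s\<^sup>2 * (s\<^sup>2 - s\<^sup>2)"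
    by (intro tendsto_intros lim)
  then have lim0: "(\<lambda>n. s\<^sup>2 * (s\<^sup>2 - (norm (B (x n)))\<^sup>2)) \<longlonglongrightarrow> 0" by simp
  have "(\<lambda>n. (norm (d n))\<^sup>2) \<longlonglongrightarrow> 0"
    by (rule tendsto_sandwich[OF _ _ tendsto_const lim0]) (simp_all add: d_le)
  then have "(\<lambda>n. sqrt ((norm (d n))\<^sup>2)) \<longlonglongrightarrow> sqrt 0" by (rule tendsto_real_sqrt)
  then have d0: "d \<longlonglongrightarrow> 0" by (simp add: tendsto_norm_zero_iff)
  have "bounded (range (\<lambda>n. B (x n)))"
    by (rule boundedI[of _ s]) (auto intro: le_s xU)
  from compact_operator_subseq[OF B(1) this]
  obtain r l where r: "strict_mono (r :: nat \<Rightarrow> nat)" and l: "(\<lambda>n. B (B (x (r n)))) \<longlonglongrightarrow> l" .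
  \<comment> \<open>\<open>x (r n)\<close> is recovered from \<open>B (B (x (r n)))\<close> and
    \<open>d (r n)\<close>, and so inherits their convergence; here \<open>s > 0\<close> is
    essential.\<close>
  have "(\<lambda>n. (1 / s\<^sup>2) *\<^sub>R (B (B (x (r n))) - d (r n))) \<longlonglongrightarrow> (1 / s\<^sup>2) *\<^sub>R (l - 0)"
    using LIMSEQ_subseq_LIMSEQ[OF d0 r] by (intro tendsto_intros l) (simp add: o_def)
  moreover have "(1 / s\<^sup>2) *\<^sub>R (B (B (x (r n))) - d (r n)) = x (r n)" for n
    using s0 by (simp add: d_def)
  ultimately have xl: "(\<lambda>n. x (r n)) \<longlonglongrightarrow> (1 / s\<^sup>2) *\<^sub>R l" by simp
  define y where "y = (1 / s\<^sup>2) *\<^sub>R l"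
  have yM: "y \<in> M" unfolding y_def by (rule closed_sequentially[OF M(2) _ xl]) (simp add: xM)
  have "(\<lambda>n. norm (x (r n))) \<longlonglongrightarrow> norm y" unfolding y_def by (intro tendsto_intros xl)
  then have "norm y = 1" using x1 by (simp add: LIMSEQ_const_iff)
  then have y0: "y \<noteq> 0" by auto
  have cont: "(\<lambda>n. B (z n)) \<longlonglongrightarrow> B w" if "z \<longlonglongrightarrow> w" for z w
    by (rule bounded_linear.tendsto[OF bounded_operator_bounded_linear[OF compact_operator_bounded[OF B(1)]] that])
  have "B (B y) = l"
    using LIMSEQ_unique[OF cont[OF cont[OF xl]] l] by (simp add: y_def)
  then have BBy: "B (B y) = s\<^sup>2 *\<^sub>R y" using s0 by (simp add: y_def)
  show thesis
  proof (cases "B y + s *\<^sub>R y = 0")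
    case True
    then have "B y = complex_of_real (- s) *\<^sub>C y"
      by (simp add: scaleR_scaleC[symmetric] add_eq_0_iff2)
    with yM y0 that show thesis by blast
  next
    case False
    have "B (B y + s *\<^sub>R y) = s *\<^sub>R (B y + s *\<^sub>R y)"
      by (simp add: lin BBy algebra_simps power2_eq_square)
    then have "B (B y + s *\<^sub>R y) = complex_of_real s *\<^sub>C (B y + s *\<^sub>R y)" by (simp add: scaleR_scaleC)
    moreover have "B y + s *\<^sub>R y \<in> M" using yM inv msub by (simp add: scaleR_scaleC)
    ultimately show thesis using False that by blast
  qed
qed

lemma closed_eigenspace:
  fixes B :: "'a::complex_hilbert \<Rightarrow> 'a"
  assumes "bounded_operator B"
  shows "closed {x. B x = c *\<^sub>C x}"
proof -
  have "bounded_operator (\<lambda>x. B x - c *\<^sub>C x)"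
    by (rule bounded_operator_diff[OF assms])
      (simp add: bounded_operator_def bounded_linear_scaleC scaleC_scaleC mult.commute)
  then have "closed ((\<lambda>x. B x - c *\<^sub>C x) -` {0})"
    by (intro continuous_closed_vimage closed_singleton ballI linear_continuous_at
        bounded_operator_bounded_linear) simp
  also have "(\<lambda>x. B x - c *\<^sub>C x) -` {0} = {x. B x = c *\<^sub>C x}" by auto
  finally show ?thesis .
qed

text \<open>Induction on the family, with \<open>M\<close> shrinking to an eigenspace of one member:
  by commutation the other operators leave that eigenspace invariant. If \<open>B\<close> vanishes
  on \<open>M\<close>, all of \<open>M\<close> belongs to the eigenvalue 0.\<close>

lemma joint_eigenvector_exists:
  fixes \<B> :: "('a::complex_hilbert \<Rightarrow> 'a) set"
  assumes fin: "finite \<B>"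
    and B: "\<And>B. B \<in> \<B> \<Longrightarrow> compact_operator B \<and> self_adjoint B"
    and comm: "\<And>B C x. B \<in> \<B> \<Longrightarrow> C \<in> \<B> \<Longrightarrow> B (C x) = C (B x)"
    and M: "complex_vector.subspace M" "closed M"
    and inv: "\<And>B x. B \<in> \<B> \<Longrightarrow> x \<in> M \<Longrightarrow> B x \<in> M" and nz: "\<exists>x\<in>M. x \<noteq> 0"
  shows "\<exists>x\<in>M. x \<noteq> 0 \<and> (\<forall>B\<in>\<B>. \<exists>c. B x = c *\<^sub>C x)"
  using fin B comm M inv nz
proof (induction \<B> arbitrary: M rule: finite_induct)
  case (insert B \<B>)
  have cB: "compact_operator B" "self_adjoint B" using insert.prems(1) by auto
  note bB = compact_operator_bounded[OF cB(1)]
  obtain x c where x: "x \<in> M" "x \<noteq> 0" "B x = c *\<^sub>C x"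
  proof (cases "\<exists>x0\<in>M. B x0 \<noteq> 0")
    case True
    then show thesis
      using compact_self_adjoint_eigenvector[OF cB insert.prems(3,4)] insert.prems(5)[of B] that
      by (metis insertI1)
  next
    case False
    then show thesis using insert.prems(6) that[of _ 0] by fastforce
  qed
  define N where "N = M \<inter> {x. B x = c *\<^sub>C x}"
  have "complex_vector.subspace {x. B x = c *\<^sub>C x}"
    by (auto simp: complex_vector.subspace_def bounded_operator_linear[OF bB] scaleC_add_right
        scaleC_scaleC mult.commute)
  then have N: "complex_vector.subspace N" "closed N"
    using insert.prems(3,4) closed_eigenspace[OF bB]
    by (auto simp: N_def complex_vector.subspace_inter)
  have "\<exists>x\<in>N. x \<noteq> 0 \<and> (\<forall>C\<in>\<B>. \<exists>c. C x = c *\<^sub>C x)"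
  proof (rule insert.IH[OF _ _ N])
    show "C x \<in> N" if "C \<in> \<B>" "x \<in> N" for C x
    proof -
      have C: "bounded_operator C" using insert.prems(1) that compact_operator_bounded by blast
      show ?thesis
        using that insert.prems(5)[of C x] insert.prems(2)[of B C x]
        by (simp add: N_def bounded_operator_linear[OF C])
    qed
    show "\<exists>x\<in>N. x \<noteq> 0" using x by (auto simp: N_def)
    show "compact_operator C \<and> self_adjoint C" if "C \<in> \<B>" for C
      using insert.prems(1) that by simp
    show "C (D x) = D (C x)" if "C \<in> \<B>" "D \<in> \<B>" for C D x
      using insert.prems(2) that by (meson insertI2)
  qed
  then show ?case by (auto simp: N_def)
next
  case empty
  from empty.prems(6) show ?case by simp
qed

text \<open>Zorn's lemma gives a maximal orthonormal set of joint eigenvectors. Self-adjointness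
  makes its orthogonal complement invariant, so a nonzero complement would contain a further joint
  eigenvector.\<close>

lemma joint_eigenbasis_exists:
  fixes \<B> :: "('a::complex_hilbert \<Rightarrow> 'a) set"
  assumes fin: "finite \<B>"
    and B: "\<And>B. B \<in> \<B> \<Longrightarrow> compact_operator B \<and> self_adjoint B"
    and comm: "\<And>B C x. B \<in> \<B> \<Longrightarrow> C \<in> \<B> \<Longrightarrow> B (C x) = C (B x)"
  shows "\<exists>E. orthonormal_set E \<and> total_set E \<and> (\<forall>e\<in>E. \<forall>B\<in>\<B>. \<exists>c. B e = c *\<^sub>C e)"
proof -
  define \<E> where "\<E> = {E. orthonormal_set E \<and> (\<forall>e\<in>E. \<forall>B\<in>\<B>. \<exists>c. B e = c *\<^sub>C e)}"
  have "\<exists>E\<in>\<E>. \<forall>X\<in>\<E>. E \<subseteq> X \<longrightarrow> X = E"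
  proof (rule subset_Zorn')
    fix \<C> assume C: "subset.chain \<E> \<C>"
    have "orthonormal_set (\<Union>\<C>)"
      unfolding orthonormal_set_def
    proof (intro ballI)
      fix x y assume "x \<in> \<Union>\<C>" "y \<in> \<Union>\<C>"
      then obtain X where "X \<in> \<C>" "x \<in> X" "y \<in> X"
        using C unfolding subset_chain_def by blast
      moreover have "orthonormal_set X" using C \<open>X \<in> \<C>\<close> by (auto simp: subset_chain_def \<E>_def)
      ultimately show "cinner x y = (if x = y then 1 else 0)" by (simp add: orthonormal_setD)
    qed
    then show "\<Union>\<C> \<in> \<E>" using C by (force simp: subset_chain_def \<E>_def)
  qed
  then obtain E where E: "E \<in> \<E>" and max: "\<And>X. X \<in> \<E> \<Longrightarrow> E \<subseteq> X \<Longrightarrow> X = E" by blast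
  have evE: "\<exists>c. B e = c *\<^sub>C e" if "e \<in> E" "B \<in> \<B>" for e B
    using E that by (simp add: \<E>_def)
  have "total_set E"
    unfolding total_set_def
  proof (intro allI impI, rule ccontr)
    fix x0 assume x0: "\<forall>e\<in>E. cinner x0 e = 0" "x0 \<noteq> 0"
    define M where "M = {x. \<forall>e\<in>E. cinner x e = 0}"
    have sub: "complex_vector.subspace M"
      by (auto simp: M_def complex_vector.subspace_def cinner_simps)
    have "M = (\<Inter>e\<in>E. (\<lambda>x. cinner x e) -` {0})" by (auto simp: M_def)
    then have cl: "closed M"
      by (auto intro!: closed_INT continuous_closed_vimage
          linear_continuous_at[OF bounded_linear_cinner_left])
    have inv: "B x \<in> M" if "B \<in> \<B>" "x \<in> M" for B x
      unfolding M_def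
    proof (intro CollectI ballI)
      fix e assume e: "e \<in> E"
      obtain c where "B e = c *\<^sub>C e" using evE[OF e \<open>B \<in> \<B>\<close>] ..
      then show "cinner (B x) e = 0"
        using that e self_adjointD[of B x e] B by (simp add: cinner_simps M_def)
    qed
    have ne: "\<exists>x\<in>M. x \<noteq> 0" using x0 by (auto simp: M_def)
    have "\<exists>x\<in>M. x \<noteq> 0 \<and> (\<forall>B\<in>\<B>. \<exists>c. B x = c *\<^sub>C x)"
      by (rule joint_eigenvector_exists[OF fin _ _ sub cl]) (fact B comm inv ne)+
    then obtain x where x: "x \<in> M" "x \<noteq> 0" and ev: "\<forall>B\<in>\<B>. \<exists>c. B x = c *\<^sub>C x" by blast
    define u where "u = (1 / norm x) *\<^sub>R x"
    have u1: "cinner u u = 1" using x by (simp add: cinner_self u_def)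
    have uE: "cinner u e = 0" "cinner e u = 0" if "e \<in> E" for e
      using x that cinner_zero_commute[of e x] by (simp_all add: u_def M_def cinner_simps)
    have "\<exists>c. B u = c *\<^sub>C u" if "B \<in> \<B>" for B
    proof -
      from bspec[OF ev that] obtain c where "B x = c *\<^sub>C x" ..
      moreover have bB: "bounded_operator B" using that B compact_operator_bounded by blast
      ultimately have "B u = c *\<^sub>C u"
        by (simp add: u_def bounded_operator_linear[OF bB] scaleR_scaleC scaleC_scaleC mult.commute)
      then show ?thesis ..
    qed
    then have "insert u E \<in> \<E>"
      using E u1 uE by (auto simp: \<E>_def orthonormal_set_def)
    then have "u \<in> E" using max[of "insert u E"] by blast
    then show False using uE(1)[of u] u1 by simp
  qed
  moreover have "orthonormal_set E" using E by (simp add: \<E>_def)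
  ultimately show ?thesis using evE by blast
qed

text \<open>Passing to adjoints lets totality apply directly: agreement on \<open>E\<close> says
  that the difference of the adjoint images of any \<open>y\<close> is orthogonal to
  \<open>E\<close>.\<close>

lemma bounded_operator_eqI_total:
  fixes S T :: "'a::complex_hilbert \<Rightarrow> 'a"
  assumes S: "bounded_operator S" and T: "bounded_operator T"
    and E: "total_set E" and eq: "\<And>e. e \<in> E \<Longrightarrow> S e = T e"
  shows "S = T"
proof
  fix x
  have adj: "hilbert_adjoint S y = hilbert_adjoint T y" for y
  proof -
    have "hilbert_adjoint S y - hilbert_adjoint T y = 0"
    proof (rule total_setD[OF E])
      fix e assume "e \<in> E"
      then show "cinner (hilbert_adjoint S y - hilbert_adjoint T y) e = 0"
        by (simp add: cinner_diff_left cinner_adjoint_left[OF S] cinner_adjoint_left[OF T] eq)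
    qed
    then show ?thesis by simp
  qed
  show "S x = T x"
    by (rule cinner_ext) (simp add: cinner_adjoint[OF S] cinner_adjoint[OF T] adj)
qed

subsection \<open>Weights bounded by one with integral total mass\<close>

lemma has_sum_minus:
  fixes f g :: "'a \<Rightarrow> 'b::topological_ab_group_add"
  assumes "(f has_sum a) A" "(g has_sum b) A"
  shows "((\<lambda>x. f x - g x) has_sum (a - b)) A"
  using has_sum_add[OF assms(1), of "\<lambda>x. - g x" "- b"] assms(2) by (simp add: has_sum_uminus)

text \<open>
  The bathtub principle: \<open>v\<close> is at most the left-hand side of \<open>ge\<close>, and the conclusion describes
  the case of equality.
\<close>
lemma bathtub_equality:
  fixes p f :: "'i \<Rightarrow> real"
  assumes p: "\<And>e. e \<in> E \<Longrightarrow> 0 \<le> p e \<and> p e \<le> 1"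
    and k: "(p has_sum k) E" and v: "((\<lambda>e. p e * f e) has_sum v) E"
    and F: "finite F" "F \<subseteq> E" "\<And>e. e \<in> F \<Longrightarrow> t \<le> f e" "\<And>e. e \<in> E - F \<Longrightarrow> f e \<le> t"
    and ge: "sum f F + (k - real (card F)) * t \<le> v" and e: "e \<in> E"
  shows "p e * (f e - t) = (if e \<in> F then f e - t else 0)"
proof -
  \<comment> \<open>\<open>g e\<close> is \<open>f e - t\<close> multiplied by the extremal weight,
    the indicator of \<open>F\<close>. Its excess over \<open>p e * (f e - t)\<close> is nonnegative
    at each \<open>e\<close> and has sum at most 0, hence vanishes throughout.\<close>
  define g where "g e = (if e \<in> F then f e - t else 0)" for e
  have h: "((\<lambda>e. p e * f e - p e * t) has_sum (v - k * t)) E"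
    by (intro has_sum_minus v has_sum_cmult_left k)
  have "(g has_sum (sum f F - real (card F) * t)) E"
    by (rule has_sum_finite_neutralI[OF F(1,2)]) (simp_all add: g_def sum_subtractf)
  then have "((\<lambda>e. g e - (p e * f e - p e * t)) has_sum
      ((sum f F - real (card F) * t) - (v - k * t))) E"
    by (rule has_sum_minus[OF _ h])
  moreover have "(sum f F - real (card F) * t) - (v - k * t) \<le> 0" using ge by (simp add: algebra_simps)
  moreover have "0 \<le> g e - (p e * f e - p e * t)" if "e \<in> E" for e
  proof (cases "e \<in> F")
    case True
    then have "0 \<le> (1 - p e) * (f e - t)" using p[OF that] F(3) by (intro mult_nonneg_nonneg) auto
    then show ?thesis using True by (simp add: g_def algebra_simps)
  next
    case False
    then have "0 \<le> p e * (t - f e)" using p[OF that] F(4) that by (intro mult_nonneg_nonneg) auto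
    then show ?thesis using False by (simp add: g_def algebra_simps)
  qed
  ultimately have "g e - (p e * f e - p e * t) = 0"
    using e by (rule nonneg_has_sum_le_0D)
  then show ?thesis by (simp add: g_def right_diff_distrib)
qed

text \<open>Strict positivity of the weights turns the equality case
  \<open>p e * (f e - t) = 0\<close> into \<open>f e = t\<close> outside \<open>T\<close>.
  \<open>E\<close> and \<open>w\<close> vary in the induction because the elements of
  \<open>T\<close>, which have weight one, are split off.\<close>

lemma has_sum_in_convex_hull_subset_sums_pos:
  fixes \<mu> :: "'i \<Rightarrow> 'v::euclidean_space"
  assumes "\<And>e. e \<in> E \<Longrightarrow> 0 < p e \<and> p e \<le> 1"
    and "(p has_sum real k) E" and "((\<lambda>e. p e *\<^sub>R \<mu> e) has_sum w) E"
  shows "w \<in> convex hull {sum \<mu> S | S. finite S \<and> S \<subseteq> E \<and> card S = k}"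
  using assms
proof (induction k arbitrary: E w rule: less_induct)
  case (less k)
  note p = less.prems(1) and pk = less.prems(2) and pw = less.prems(3)
  define X where "X E k = {sum \<mu> S | S. finite S \<and> S \<subseteq> E \<and> card S = k}" for E k
  show ?case
  proof (cases "k = 0")
    case True
    have "E = {}"
    proof (rule ccontr)
      assume "E \<noteq> {}"
      then obtain e where e: "e \<in> E" by blast
      have "p e = 0"
        by (rule nonneg_has_sum_le_0D[OF pk _ _ e]) (use p True in \<open>auto intro: less_imp_le\<close>)
      then show False using p[OF e] by simp
    qed
    then have "w = 0" using pw has_sum_empty has_sum_unique by metis
    moreover have "sum \<mu> {} \<in> X E k" unfolding X_def using True by force
    ultimately have "w \<in> convex hull (X E k)" by (simp add: hull_inc)
    then show ?thesis by (simp add: X_def)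
  next
    case False
    \<comment> \<open>Weights at most 1 of total mass \<open>k\<close> need at least
      \<open>k\<close> indices; this makes the hull to be separated nonempty.\<close>
    have large: "\<exists>S\<subseteq>E. finite S \<and> card S = k"
    proof (cases "finite E")
      case True
      then have "real k = sum p E" using pk has_sum_finite has_sum_unique by metis
      also have "\<dots> \<le> (\<Sum>e\<in>E. 1)" by (rule sum_mono) (use p in auto)
      finally have "k \<le> card E" by simp
      then show ?thesis by (metis obtain_subset_with_card_n)
    qed (metis infinite_arbitrarily_large)
    let ?C = "convex hull (X E k)"
    have "w \<in> ?C"
    proof (rule ccontr)
      assume w: "w \<notin> ?C"
      define D where "D = (\<lambda>c. c - w) ` ?C"
      have "convex D" unfolding D_def by (intro convex_translation_subtract convex_convex_hull)
      moreover have "D \<noteq> {}" using large by (auto simp: D_def X_def)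
      moreover have "0 \<notin> D" using w by (auto simp: D_def)
      ultimately obtain a where a: "a \<in> span D" "a \<noteq> 0" and aD: "\<And>x. x \<in> D \<Longrightarrow> 0 \<le> a \<bullet> x"
        using separating_hyperplane_set_0_inspan by metis
      define f where "f e = - (a \<bullet> \<mu> e)" for e
      define v where "v = - (a \<bullet> w)"
      have pf: "((\<lambda>e. p e * f e) has_sum v) E"
        using has_sum_bounded_linear[OF bounded_linear_inner_right[of "- a"] pw]
        by (simp add: f_def v_def)
      have fS: "sum f S \<le> v" if "finite S" "S \<subseteq> E" "card S = k" for S
      proof -
        have "sum \<mu> S \<in> ?C" by (rule hull_inc) (use that in \<open>auto simp: X_def\<close>)
        then have "0 \<le> a \<bullet> (sum \<mu> S - w)" by (intro aD) (simp add: D_def)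
        then show ?thesis by (simp add: f_def v_def inner_diff_right inner_sum_right sum_negf)
      qed
      \<comment> \<open>\<open>t\<close> is the \<open>k\<close>-th largest value of
        \<open>f\<close> on \<open>E\<close>, counted with multiplicity. It is taken as a supremum
        because on an infinite \<open>E\<close> it need not be attained.\<close>
      define Z where "Z = {s. \<exists>S\<subseteq>E. finite S \<and> card S = k \<and> (\<forall>e\<in>S. s \<le> f e)}"
      define t where "t = Sup Z"
      define T where "T = {e\<in>E. t < f e}"
      have MinZ: "Min (f ` S) \<in> Z" if "S \<subseteq> E" "finite S" "card S = k" for S
        unfolding Z_def using that by (auto intro!: exI[of _ S])
      have Zne: "Z \<noteq> {}" using large MinZ by blast
      have "s \<le> v / real k" if "s \<in> Z" for s
      proof -
        obtain S where S: "S \<subseteq> E" "finite S" "card S = k" "\<forall>e\<in>S. s \<le> f e"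
          using \<open>s \<in> Z\<close> unfolding Z_def by blast
        have "real k * s \<le> sum f S" using sum_bounded_below[of S s f] S by simp
        also have "\<dots> \<le> v" using fS S by simp
        finally show ?thesis using False by (simp add: pos_le_divide_eq mult.commute)
      qed
      then have Zbdd: "bdd_above Z" by (rule bdd_aboveI)
      have T: "finite T \<and> card T < k"
      proof (rule ccontr)
        assume "\<not> (finite T \<and> card T < k)"
        then obtain S where S: "S \<subseteq> T" "finite S" "card S = k"
          by (metis infinite_arbitrarily_large not_less obtain_subset_with_card_n)
        then have "S \<noteq> {}" using False by auto
        then have "t < Min (f ` S)" using S by (auto simp: T_def)
        moreover have "Min (f ` S) \<le> t"
          unfolding t_def by (rule cSup_upper[OF MinZ Zbdd]) (use S in \<open>auto simp: T_def\<close>)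
        ultimately show False by simp
      qed
      \<comment> \<open>Completing \<open>T\<close> to \<open>k\<close> elements by members of
        \<open>S\<close> outside \<open>T\<close>, where \<open>f\<close> exceeds \<open>s\<close>,
        gives the bathtub bound with \<open>s\<close> in place of \<open>t\<close>. Letting
        \<open>s\<close> increase to \<open>t\<close> makes up for a \<open>t\<close> that is not
        attained.\<close>
      have "s \<le> (v - sum f T) / real (k - card T)" if "s < t" for s
      proof -
        obtain s' where s': "s' \<in> Z" "s < s'" using \<open>s < t\<close> less_cSup_iff[OF Zne Zbdd] t_def by auto
        then obtain S where S: "S \<subseteq> E" "finite S" "card S = k" "\<forall>e\<in>S. s' \<le> f e"
          unfolding Z_def by blast
        have "k - card T \<le> card (S - T)" using S T diff_card_le_card_Diff[of T S] by simp
        then obtain U where U: "U \<subseteq> S - T" "card U = k - card T" "finite U"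
          by (metis obtain_subset_with_card_n)
        have disj: "T \<inter> U = {}" using U by auto
        have "sum f (T \<union> U) \<le> v"
        proof (rule fS)
          show "T \<union> U \<subseteq> E" using U S by (auto simp: T_def)
          show "card (T \<union> U) = k" using T U disj by (simp add: card_Un_disjoint)
        qed (use T U in simp)
        then have "sum f T + sum f U \<le> v" using T U disj by (simp add: sum.union_disjoint)
        moreover have "real (card U) * s \<le> sum f U"
          by (rule sum_bounded_below) (use U S s' in force)
        ultimately have "s * real (k - card T) \<le> v - sum f T"
          using U by (simp add: mult.commute)
        then show ?thesis using T by (simp add: pos_le_divide_eq)
      qed
      then have "t \<le> (v - sum f T) / real (k - card T)" by (rule dense_le)
      then have "sum f T + (real k - real (card T)) * t \<le> v"
        using T by (simp add: pos_le_divide_eq of_nat_diff mult.commute)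
      then have eq: "p e * (f e - t) = (if e \<in> T then f e - t else 0)" if "e \<in> E" for e
        using that T p by (intro bathtub_equality[OF _ pk pf]) (auto simp: T_def intro: less_imp_le)
      have pT: "p e = 1" if "e \<in> T" for e
        using eq[of e] that by (auto simp: T_def)
      have ft: "f e = t" if "e \<in> E" "e \<notin> T" for e
        using eq[OF that(1)] that p[OF that(1)] by auto
      \<comment> \<open>With \<open>T\<close> empty, \<open>f\<close> is constant on
        \<open>E\<close>, so all subset sums lie in one hyperplane through \<open>w\<close>. Then
        \<open>a\<close> is orthogonal to \<open>D\<close>, contradicting that it is a nonzero
        vector of \<open>span D\<close>.\<close>
      have "T \<noteq> {}"
      proof
        assume "T = {}"
        then have ft: "f e = t" if "e \<in> E" for e using ft that by blast
        have "((\<lambda>e. p e * f e) has_sum (real k * t)) E"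
          using has_sum_cmult_left[OF pk, of t] by (rule has_sum_cong[THEN iffD1, rotated]) (simp add: ft)
        then have v: "v = real k * t" using pf has_sum_unique by blast
        have "X E k \<subseteq> {x. a \<bullet> x = - (real k * t)}"
        proof
          fix x assume "x \<in> X E k"
          then obtain S where S: "x = sum \<mu> S" "S \<subseteq> E" "card S = k" by (auto simp: X_def)
          have "a \<bullet> x = (\<Sum>e\<in>S. - f e)" by (simp add: S f_def inner_sum_right)
          also have "\<dots> = (\<Sum>e\<in>S. - t)" using S ft by (intro sum.cong) auto
          finally show "x \<in> {x. a \<bullet> x = - (real k * t)}" using S by simp
        qed
        then have "?C \<subseteq> {x. a \<bullet> x = - (real k * t)}" by (rule hull_minimal) (rule convex_hyperplane)
        then have "a \<bullet> x = 0" if "x \<in> D" for x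
          using that v by (auto simp: D_def v_def inner_diff_right)
        then have "orthogonal a a"
          by (intro orthogonal_to_span[OF a(1)]) (simp add: orthogonal_def)
        then show False using a(2) by (simp add: orthogonal_def)
      qed
      then have cT: "0 < card T" using T by (simp add: card_gt_0_iff)
      have TE: "T \<subseteq> E" by (auto simp: T_def)
      \<comment> \<open>All of \<open>T\<close> has weight one, so subtracting
        \<open>sum \<mu> T\<close> leaves weights on \<open>E - T\<close> whose total mass
        \<open>k - card T\<close> is smaller than \<open>k\<close>.\<close>
      have "w - sum \<mu> T \<in> convex hull (X (E - T) (k - card T))"
        unfolding X_def
      proof (rule less.IH)
        show "k - card T < k" using cT T by simp
        have "(p has_sum (real k - sum p T)) (E - T)"
          by (rule has_sum_Diff[OF pk _ TE]) (use T in simp)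
        then show "(p has_sum real (k - card T)) (E - T)" using pT T by (simp add: of_nat_diff)
        have "((\<lambda>e. p e *\<^sub>R \<mu> e) has_sum (w - (\<Sum>e\<in>T. p e *\<^sub>R \<mu> e))) (E - T)"
          by (rule has_sum_Diff[OF pw _ TE]) (use T in simp)
        then show "((\<lambda>e. p e *\<^sub>R \<mu> e) has_sum (w - sum \<mu> T)) (E - T)" using pT by simp
      qed (use p in auto)
      then have "w \<in> (\<lambda>x. sum \<mu> T + x) ` (convex hull (X (E - T) (k - card T)))"
        by (intro image_eqI[of _ _ "w - sum \<mu> T"]) simp_all
      also have "\<dots> = convex hull ((\<lambda>x. sum \<mu> T + x) ` X (E - T) (k - card T))"
        by (simp add: convex_hull_translation)
      also have "\<dots> \<subseteq> ?C"
      proof (rule hull_mono, rule image_subsetI)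
        fix x assume "x \<in> X (E - T) (k - card T)"
        then obtain S where S: "x = sum \<mu> S" "finite S" "S \<subseteq> E - T" "card S = k - card T"
          by (auto simp: X_def)
        then have disj: "T \<inter> S = {}" by auto
        have "sum \<mu> T + x = sum \<mu> (T \<union> S)" using S T disj by (simp add: sum.union_disjoint)
        moreover have "card (T \<union> S) = k" using S T disj by (simp add: card_Un_disjoint)
        ultimately show "sum \<mu> T + x \<in> X E k" using S T TE by (auto simp: X_def)
      qed
      finally show False using w by simp
    qed
    then show ?thesis by (simp add: X_def)
  qed
qed

text \<open>Indices of weight zero contribute to neither series and are discarded to reach strictly
  positive weights.\<close>

lemma has_sum_in_convex_hull_subset_sums:
  fixes \<mu> :: "'i \<Rightarrow> 'v::euclidean_space"
  assumes p: "\<And>e. e \<in> E \<Longrightarrow> 0 \<le> p e \<and> p e \<le> 1"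
    and pk: "(p has_sum real k) E" and pw: "((\<lambda>e. p e *\<^sub>R \<mu> e) has_sum w) E"
  shows "w \<in> convex hull {sum \<mu> S | S. finite S \<and> S \<subseteq> E \<and> card S = k}"
proof -
  define E' where "E' = {e\<in>E. p e \<noteq> 0}"
  have "(p has_sum real k) E'"
    using pk by (rule has_sum_cong_neutral[THEN iffD1, rotated -1]) (auto simp: E'_def)
  moreover have "((\<lambda>e. p e *\<^sub>R \<mu> e) has_sum w) E'"
    using pw by (rule has_sum_cong_neutral[THEN iffD1, rotated -1]) (auto simp: E'_def)
  ultimately have "w \<in> convex hull {sum \<mu> S | S. finite S \<and> S \<subseteq> E' \<and> card S = k}"
    using p by (intro has_sum_in_convex_hull_subset_sums_pos) (auto simp: E'_def less_le)
  also have "\<dots> \<subseteq> convex hull {sum \<mu> S | S. finite S \<and> S \<subseteq> E \<and> card S = k}"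
    by (rule hull_mono) (auto simp: E'_def)
  finally show ?thesis .
qed

text \<open>The weighted sums form a convex set that contains the subset sums: \<open>q'\<close> and
  \<open>r'\<close> extend two weight functions by zero to the union of their supports, where they
  can be averaged. The weights become the diagonal of a projection below.\<close>

lemma convex_hull_subset_sums_weights:
  fixes \<mu> :: "'i \<Rightarrow> 'v::real_vector"
  assumes w: "w \<in> convex hull {sum \<mu> S | S. finite S \<and> S \<subseteq> E \<and> card S = k}"
  shows "\<exists>F q. finite F \<and> F \<subseteq> E \<and> (\<forall>e\<in>F. 0 \<le> q e \<and> q e \<le> 1) \<and> sum q F = real k
    \<and> w = (\<Sum>e\<in>F. q e *\<^sub>R \<mu> e)"
proof -
  define Q where "Q = {w. \<exists>F q. finite F \<and> F \<subseteq> E \<and> (\<forall>e\<in>F. 0 \<le> q e \<and> q e \<le> 1) \<and> sum q F = real k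
      \<and> w = (\<Sum>e\<in>F. q e *\<^sub>R \<mu> e)}"
  have "{sum \<mu> S | S. finite S \<and> S \<subseteq> E \<and> card S = k} \<subseteq> Q"
  proof clarify
    fix S assume "finite S" "S \<subseteq> E" "k = card S"
    then show "sum \<mu> S \<in> Q"
      unfolding Q_def by (intro CollectI exI[of _ S] exI[of _ "\<lambda>_. 1"]) simp
  qed
  moreover have "convex Q"
  proof (rule convexI)
    fix x y and u v :: real
    assume xQ: "x \<in> Q" and yQ: "y \<in> Q" and uv: "0 \<le> u" "0 \<le> v" "u + v = 1"
    obtain F q where F: "finite F" "F \<subseteq> E" "\<forall>e\<in>F. 0 \<le> q e \<and> q e \<le> 1" "sum q F = real k"
      and x: "x = (\<Sum>e\<in>F. q e *\<^sub>R \<mu> e)" using xQ unfolding Q_def by blast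
    obtain G r where G: "finite G" "G \<subseteq> E" "\<forall>e\<in>G. 0 \<le> r e \<and> r e \<le> 1" "sum r G = real k"
      and y: "y = (\<Sum>e\<in>G. r e *\<^sub>R \<mu> e)" using yQ unfolding Q_def by blast
    define q' where "q' e = (if e \<in> F then q e else 0)" for e
    define r' where "r' e = (if e \<in> G then r e else 0)" for e
    have q': "0 \<le> q' e" "q' e \<le> 1" and r': "0 \<le> r' e" "r' e \<le> 1" for e
      using F G by (auto simp: q'_def r'_def)
    have sq: "sum q' (F \<union> G) = real k" "sum r' (F \<union> G) = real k"
      using F G by (auto simp: q'_def r'_def sum.If_cases Int_absorb1 Int_absorb2)
    have xs: "x = (\<Sum>e\<in>F \<union> G. q' e *\<^sub>R \<mu> e)" unfolding x
      by (rule sum.mono_neutral_cong_left) (use F G in \<open>auto simp: q'_def\<close>)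
    have ys: "y = (\<Sum>e\<in>F \<union> G. r' e *\<^sub>R \<mu> e)" unfolding y
      by (rule sum.mono_neutral_cong_left) (use F G in \<open>auto simp: r'_def\<close>)
    show "u *\<^sub>R x + v *\<^sub>R y \<in> Q"
      unfolding Q_def
    proof (intro CollectI exI conjI ballI)
      show "finite (F \<union> G)" "F \<union> G \<subseteq> E" using F G by auto
      show "0 \<le> u * q' e + v * r' e" for e using uv q' r' by simp
      show "u * q' e + v * r' e \<le> 1" for e using uv q' r' by (intro convex_bound_le)
      show "(\<Sum>e\<in>F \<union> G. u * q' e + v * r' e) = real k"
        using uv by (simp add: sum.distrib sum_distrib_left[symmetric] sq distrib_right[symmetric])
      show "u *\<^sub>R x + v *\<^sub>R y = (\<Sum>e\<in>F \<union> G. (u * q' e + v * r' e) *\<^sub>R \<mu> e)"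
        by (simp add: xs ys scaleR_add_left sum.distrib scaleR_sum_right)
    qed
  qed
  ultimately have "w \<in> Q" using w hull_minimal[of _ Q convex] by blast
  then show ?thesis by (simp add: Q_def)
qed

text \<open>
  The Schur--Horn theorem for projections: the rows \<open>c l\<close> span the range of a projection with
  diagonal \<open>q\<close>. Two fractional entries of \<open>q\<close> are moved apart until one of them is integral; the
  given diagonal is recovered by a rotation in the plane of the two coordinates.
\<close>
lemma projection_with_diagonal:
  fixes q :: "'i \<Rightarrow> real"
  assumes F: "finite F" and q: "\<And>e. e \<in> F \<Longrightarrow> 0 \<le> q e \<and> q e \<le> 1" and sum: "sum q F = real k"
  shows "\<exists>c :: nat \<Rightarrow> 'i \<Rightarrow> real.
    (\<forall>l<k. \<forall>m<k. (\<Sum>e\<in>F. c l e * c m e) = (if l = m then 1 else 0)) \<and>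
    (\<forall>e\<in>F. (\<Sum>l<k. (c l e)\<^sup>2) = q e)"
  using q sum
proof (induction "card {e\<in>F. 0 < q e \<and> q e < 1}" arbitrary: q rule: less_induct)
  case less
  note q = less.prems(1) and sum = less.prems(2)
  show ?case
  proof (cases "{e\<in>F. 0 < q e \<and> q e < 1} = {}")
    case True
    define S where "S = {e\<in>F. q e = 1}"
    have q01: "q e = (if e \<in> S then 1 else 0)" if "e \<in> F" for e
      using True q[OF that] that by (force simp: S_def)
    then have "sum q F = (\<Sum>e\<in>F. if e \<in> S then 1 else 0)" by (rule sum.cong[OF refl])
    also have "\<dots> = real (card S)" using F by (simp add: sum.If_cases S_def Int_def)
    finally have "card S = k" using sum by simp
    moreover have "finite S" using F by (simp add: S_def)
    ultimately obtain h where h: "bij_betw h {..<k} S"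
      by (metis ex_bij_betw_nat_finite atLeast0LessThan)
    have hS: "h l \<in> S" "h l \<in> F" if "l < k" for l
      using bij_betwE[OF h] that by (auto simp: S_def)
    have hinj: "h l = h m \<longleftrightarrow> l = m" if "l < k" "m < k" for l m
      using h that by (auto simp: bij_betw_def inj_on_def)
    show ?thesis
    proof (intro exI[of _ "\<lambda>l e. if e = h l then 1 else 0"] conjI allI impI ballI)
      fix l m assume lm: "l < k" "m < k"
      have "(\<Sum>e\<in>F. (if e = h l then 1 else 0 :: real) * (if e = h m then 1 else 0))
          = (\<Sum>e\<in>F. if e = h l then (if h l = h m then 1 else 0) else 0)"
        by (rule sum.cong) auto
      also have "\<dots> = (if l = m then 1 else 0)" using F hS lm hinj by (simp add: sum.delta)
      finally show "(\<Sum>e\<in>F. (if e = h l then 1 else 0 :: real) * (if e = h m then 1 else 0))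
          = (if l = m then 1 else 0)" .
    next
      fix e assume e: "e \<in> F"
      show "(\<Sum>l<k. (if e = h l then 1 else 0 :: real)\<^sup>2) = q e"
      proof (cases "e \<in> S")
        case True
        then obtain m where m: "m < k" "e = h m" using bij_betw_imp_surj_on[OF h] by blast
        have "(\<Sum>l<k. (if e = h l then 1 else 0 :: real)\<^sup>2) = (\<Sum>l<k. if l = m then 1 else 0)"
          by (rule sum.cong) (use m hinj in auto)
        then show ?thesis using m q01[OF e] True by simp
      next
        case False
        have "(\<Sum>l<k. (if e = h l then 1 else 0 :: real)\<^sup>2) = 0"
          by (rule sum.neutral) (use False hS in auto)
        then show ?thesis using q01[OF e] False by simp
      qed
    qed
  next
    case False
    then obtain a where a: "a \<in> F" "0 < q a" "q a < 1" by blast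
    \<comment> \<open>The total is an integer, so a fractional entry cannot be the only one.\<close>
    have "\<exists>b\<in>F - {a}. 0 < q b \<and> q b < 1"
    proof (rule ccontr)
      assume "\<not> ?thesis"
      then have q01: "q e = (if q e = 1 then 1 else 0)" if "e \<in> F - {a}" for e
        using q[of e] that by force
      have "sum q (F - {a}) = (\<Sum>e\<in>F - {a}. if q e = 1 then 1 else 0)"
        by (rule sum.cong[OF refl]) (rule q01)
      also have "\<dots> = real (card ((F - {a}) \<inter> {e. q e = 1}))" using F by (simp add: sum.If_cases)
      finally have "q a = real_of_int (int k - int (card ((F - {a}) \<inter> {e. q e = 1})))"
        using sum sum.remove[OF F a(1), of q] by simp
      then show False using a by simp
    qed
    then obtain b where b: "b \<in> F" "b \<noteq> a" "0 < q b" "q b < 1" by blast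
    obtain i j where ij: "i \<in> F" "j \<in> F" "i \<noteq> j" "0 < q j" "q j \<le> q i" "q i < 1"
      using a b by (metis linorder_le_cases)
    \<comment> \<open>The largest amount that can move from the smaller entry \<open>j\<close> to
      the larger entry \<open>i\<close> within the unit interval; afterwards entry \<open>i\<close>
      is 1 or entry \<open>j\<close> is 0.\<close>
    define s where "s = min (1 - q i) (q j)"
    have s: "0 < s" "s \<le> 1 - q i" "s \<le> q j" "s = 1 - q i \<or> s = q j"
      using ij by (auto simp: s_def)
    define q' where "q' = q(i := q i + s, j := q j - s)"
    have q'v: "q' i = q i + s" "q' j = q j - s" "\<And>e. e \<noteq> i \<Longrightarrow> e \<noteq> j \<Longrightarrow> q' e = q e"
      using ij by (simp_all add: q'_def)
    define R where "R = F - {i, j}"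
    have split: "sum g F = g i + g j + sum g R" for g :: "'i \<Rightarrow> real"
    proof -
      have "F = insert i (insert j R)" "i \<notin> insert j R" "j \<notin> R" "finite R"
        using ij F by (auto simp: R_def)
      then show ?thesis by simp
    qed
    have "sum q' R = sum q R" by (rule sum.cong) (auto simp: R_def q'v)
    then have sum': "sum q' F = real k" using sum by (simp add: split q'v)
    have bounds: "0 \<le> q' e \<and> q' e \<le> 1" if "e \<in> F" for e
      using q[OF that] q[OF ij(1)] q[OF ij(2)] s ij(5) by (simp add: q'_def)
    have "{e\<in>F. 0 < q' e \<and> q' e < 1} \<subset> {e\<in>F. 0 < q e \<and> q e < 1}"
    proof (rule psubsetI)
      show "{e\<in>F. 0 < q' e \<and> q' e < 1} \<subseteq> {e\<in>F. 0 < q e \<and> q e < 1}"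
        using ij s by (auto simp: q'_def split: if_splits)
      show "{e\<in>F. 0 < q' e \<and> q' e < 1} \<noteq> {e\<in>F. 0 < q e \<and> q e < 1}"
      proof (cases "s = q j")
        case True
        then have "j \<notin> {e\<in>F. 0 < q' e \<and> q' e < 1}" by (simp add: q'v)
        moreover have "j \<in> {e\<in>F. 0 < q e \<and> q e < 1}" using ij by simp
        ultimately show ?thesis by blast
      next
        case False
        then have "i \<notin> {e\<in>F. 0 < q' e \<and> q' e < 1}" using s by (simp add: q'v)
        moreover have "i \<in> {e\<in>F. 0 < q e \<and> q e < 1}" using ij by simp
        ultimately show ?thesis by blast
      qed
    qed
    then have "card {e\<in>F. 0 < q' e \<and> q' e < 1} < card {e\<in>F. 0 < q e \<and> q e < 1}"
      using F by (intro psubset_card_mono) auto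
    from less.hyps[OF this bounds sum']
    obtain c :: "nat \<Rightarrow> 'i \<Rightarrow> real" where
      c: "\<And>l m. l < k \<Longrightarrow> m < k \<Longrightarrow> (\<Sum>e\<in>F. c l e * c m e) = (if l = m then 1 else 0)" and
      cq: "\<And>e. e \<in> F \<Longrightarrow> (\<Sum>l<k. (c l e)\<^sup>2) = q' e" by blast
    \<comment> \<open>\<open>G \<theta>\<close> is the diagonal entry at \<open>i\<close> after
      rotating the coordinates \<open>i\<close> and \<open>j\<close> by \<open>\<theta>\<close>. It
      runs from \<open>q' i\<close>, which is above \<open>q i\<close>, to \<open>q' j\<close>,
      which is at most \<open>q i\<close>.\<close>
    define G where "G \<theta> = (\<Sum>l<k. (cos \<theta> * c l i - sin \<theta> * c l j)\<^sup>2)" for \<theta>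
    have "\<exists>\<theta>. 0 \<le> \<theta> \<and> \<theta> \<le> pi / 2 \<and> G \<theta> = q i"
    proof (rule IVT2')
      show "G (pi / 2) \<le> q i" "q i \<le> G 0" using cq ij s by (simp_all add: G_def q'v)
      show "continuous_on {0..pi / 2} G" unfolding G_def by (intro continuous_intros)
    qed simp
    then obtain \<theta> where \<theta>: "G \<theta> = q i" by blast
    define d where "d l = (c l)(i := cos \<theta> * c l i - sin \<theta> * c l j, j := sin \<theta> * c l i + cos \<theta> * c l j)" for l
    have dv: "d l i = cos \<theta> * c l i - sin \<theta> * c l j" "d l j = sin \<theta> * c l i + cos \<theta> * c l j"
      "\<And>e. e \<noteq> i \<Longrightarrow> e \<noteq> j \<Longrightarrow> d l e = c l e" for l
      using ij by (simp_all add: d_def)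
    have rot: "d l i * d m i + d l j * d m j = c l i * c m i + c l j * c m j" for l m
    proof -
      have "d l i * d m i + d l j * d m j
          = ((cos \<theta>)\<^sup>2 + (sin \<theta>)\<^sup>2) * (c l i * c m i + c l j * c m j)"
        unfolding dv power2_eq_square by algebra
      then show ?thesis by simp
    qed
    show ?thesis
    proof (intro exI[of _ d] conjI allI impI ballI)
      fix l m assume lm: "l < k" "m < k"
      have "(\<Sum>e\<in>R. d l e * d m e) = (\<Sum>e\<in>R. c l e * c m e)"
        by (rule sum.cong) (auto simp: R_def dv)
      then have "(\<Sum>e\<in>F. d l e * d m e) = (\<Sum>e\<in>F. c l e * c m e)" using rot[of l m] by (simp add: split)
      then show "(\<Sum>e\<in>F. d l e * d m e) = (if l = m then 1 else 0)" using c[OF lm] by simp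
    next
      fix e assume e: "e \<in> F"
      have di: "(\<Sum>l<k. (d l i)\<^sup>2) = q i" using \<theta> by (simp add: G_def dv)
      \<comment> \<open>The rotation preserves the sum of the two diagonal entries, as did the
        transfer by \<open>s\<close>, so the correct entry at \<open>i\<close> forces the correct
        entry at \<open>j\<close>.\<close>
      have "(\<Sum>l<k. (d l i)\<^sup>2) + (\<Sum>l<k. (d l j)\<^sup>2) = (\<Sum>l<k. (c l i)\<^sup>2) + (\<Sum>l<k. (c l j)\<^sup>2)"
        using rot[of l l for l] by (simp add: power2_eq_square flip: sum.distrib)
      then have dj: "(\<Sum>l<k. (d l j)\<^sup>2) = q j" using cq ij di by (simp add: q'v)
      show "(\<Sum>l<k. (d l e)\<^sup>2) = q e"
      proof (cases "e = i \<or> e = j")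
        case True
        then show ?thesis using di dj by blast
      next
        case False
        then show ?thesis using cq[OF e] by (simp add: dv q'v)
      qed
    qed
  qed
qed

subsection \<open>Normal compact operators\<close>

lemma normal_operatorD: "normal_operator T \<Longrightarrow> T (hilbert_adjoint T x) = hilbert_adjoint T (T x)"
  unfolding normal_operator_def by (meson comp_eq_elim)

text \<open>By normality \<open>T u = c *\<^sub>C u\<close>, and the two terms of
  \<open>cinner u u\<close> then cancel. The vector \<open>x\<close> may be zero, which matters when
  it arises as an image of an eigenvector.\<close>

lemma normal_adjoint_eigenvector:
  fixes T :: "'a::complex_hilbert \<Rightarrow> 'a"
  assumes T: "normal_operator T" and x: "T x = c *\<^sub>C x"
  shows "hilbert_adjoint T x = cnj c *\<^sub>C x"
proof -
  have bT: "bounded_operator T" using T by (simp add: normal_operator_def)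
  let ?S = "hilbert_adjoint T"
  note lin = bounded_operator_linear[OF bT] bounded_operator_linear[OF bounded_operator_adjoint[OF bT]]
  define u where "u = ?S x - cnj c *\<^sub>C x"
  have "T u = ?S (T x) - cnj c *\<^sub>C T x" by (simp add: u_def lin normal_operatorD[OF T])
  also have "\<dots> = c *\<^sub>C u"
    by (simp add: u_def x lin scaleC_scaleC mult.commute complex_vector.scale_right_diff_distrib)
  finally have Tu: "T u = c *\<^sub>C u" .
  have "cinner u u = cinner x (T u) - cinner (cnj c *\<^sub>C x) u"
    by (simp add: u_def cinner_diff_left cinner_adjoint_left[OF bT])
  then have "cinner u u = 0" by (simp add: Tu cinner_simps)
  then show ?thesis by (simp add: u_def)
qed

text \<open>\<open>R j\<close> is twice the real part and \<open>I j\<close> minus twice the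
  imaginary part of \<open>A j\<close>; these are commuting compact self-adjoint operators.
  Commutation with the adjoints is an assumption here because Fuglede's theorem below rests on the
  case of a single normal operator.\<close>

lemma commuting_family_eigenbasis:
  fixes A :: "'m::finite \<Rightarrow> 'a::complex_hilbert \<Rightarrow> 'a"
  assumes cA: "\<And>j. compact_operator (A j)"
    and comm: "\<And>i j x. A i (A j x) = A j (A i x)"
    and comm': "\<And>i j x. A i (hilbert_adjoint (A j) x) = hilbert_adjoint (A j) (A i x)"
  shows "\<exists>E. orthonormal_set E \<and> total_set E \<and> (\<forall>e\<in>E. \<forall>j. \<exists>c. A j e = c *\<^sub>C e)"
proof -
  define S where "S j = hilbert_adjoint (A j)" for j
  note bA = compact_operator_bounded[OF cA]
  have cS: "compact_operator (S j)" for j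
    unfolding S_def by (rule compact_operator_adjoint[OF cA])
  note bS = compact_operator_bounded[OF cS]
  have adj: "cinner (A j x) y = cinner x (S j y)" "cinner (S j x) y = cinner x (A j y)" for j x y
    by (simp_all add: S_def cinner_adjoint[OF bA] cinner_adjoint_left[OF bA])
  have AS: "A i (S j x) = S j (A i x)" for i j x by (simp add: S_def comm')
  have SS: "S i (S j x) = S j (S i x)" for i j x
    by (rule cinner_ext) (simp add: adj comm)
  define R where "R j x = A j x + S j x" for j x
  define I where "I j x = \<i> *\<^sub>C (A j x - S j x)" for j x
  note Alin = bounded_operator_linear[OF bA] and Slin = bounded_operator_linear[OF bS]
  note scale = complex_vector.scale_right_distrib complex_vector.scale_right_diff_distrib
  have cR: "compact_operator (R j)" for j
    unfolding R_def[abs_def] by (rule compact_operator_add[OF cA cS])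
  have cI: "compact_operator (I j)" for j
    unfolding I_def[abs_def] by (rule compact_operator_scaleC[OF compact_operator_diff[OF cA cS]])
  have sR: "self_adjoint (R j)" for j
    by (simp add: self_adjoint_def R_def cinner_simps adj)
  have sI: "self_adjoint (I j)" for j
    by (simp add: self_adjoint_def I_def cinner_simps adj algebra_simps)
  have RR: "R i (R j x) = R j (R i x)" for i j x
    by (simp add: R_def Alin Slin AS SS[of i j] comm[of i j] ac_simps)
  have RI: "R i (I j x) = I j (R i x)" for i j x
    by (simp add: R_def I_def Alin Slin AS SS[of i j] comm[of i j] scale algebra_simps)
  have II: "I i (I j x) = I j (I i x)" for i j x
    by (simp add: I_def Alin Slin AS SS[of i j] comm[of i j] scale algebra_simps)
  have "\<exists>E. orthonormal_set E \<and> total_set E \<and> (\<forall>e\<in>E. \<forall>B\<in>range R \<union> range I. \<exists>c. B e = c *\<^sub>C e)"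
  proof (rule joint_eigenbasis_exists)
    show "finite (range R \<union> range I)" by simp
    show "compact_operator B \<and> self_adjoint B" if "B \<in> range R \<union> range I" for B
      using that cR cI sR sI by blast
    show "B (C x) = C (B x)" if B: "B \<in> range R \<union> range I" and C: "C \<in> range R \<union> range I" for B C x
    proof -
      obtain i where i: "B = R i \<or> B = I i" using B by blast
      obtain j where j: "C = R j \<or> C = I j" using C by blast
      from i j show ?thesis
        by (elim disjE; hypsubst) (rule RR RI RI[symmetric] II)+
    qed
  qed
  then obtain E where E: "orthonormal_set E" "total_set E"
    and ev: "\<forall>e\<in>E. \<forall>B\<in>range R \<union> range I. \<exists>c. B e = c *\<^sub>C e" by blast
  have "\<exists>c. A j e = c *\<^sub>C e" if e: "e \<in> E" for e j
  proof -
    have "\<exists>r. R j e = r *\<^sub>C e" "\<exists>s. I j e = s *\<^sub>C e" using ev e by simp_all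
    then obtain r s where r: "R j e = r *\<^sub>C e" and s: "I j e = s *\<^sub>C e" by (elim exE)
    have "R j e + (- \<i>) *\<^sub>C I j e = A j e + A j e"
      by (simp add: R_def I_def scaleC_scaleC scaleC_one)
    moreover have "(1 / 2) *\<^sub>C (A j e + A j e) = A j e"
      by (simp add: scaleC_add_right scaleC_add_left[symmetric] scaleC_one)
    ultimately have "A j e = (1 / 2) *\<^sub>C (R j e + (- \<i>) *\<^sub>C I j e)" by simp
    then have "A j e = (1 / 2) *\<^sub>C (r *\<^sub>C e + (- \<i>) *\<^sub>C s *\<^sub>C e)"
      by (simp only: r s)
    then have "A j e = ((1 / 2) * (r + (- \<i>) * s)) *\<^sub>C e"
      by (simp only: scaleC_scaleC scaleC_add_left[symmetric])
    then show ?thesis ..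
  qed
  with E show ?thesis by blast
qed

lemma normal_compact_eigenbasis:
  fixes T :: "'a::complex_hilbert \<Rightarrow> 'a"
  assumes T: "compact_operator T" "normal_operator T"
  shows "\<exists>E. orthonormal_set E \<and> total_set E \<and> (\<forall>e\<in>E. \<exists>c. T e = c *\<^sub>C e)"
  using commuting_family_eigenbasis[of "\<lambda>_::unit. T"] by (simp add: T normal_operatorD)

text \<open>If \<open>T e = c *\<^sub>C e\<close>, then \<open>S e\<close> satisfies the same
  equation, and the adjoint of \<open>T\<close> acts on both vectors as \<open>cnj c\<close>.
  Agreement on a total set of such \<open>e\<close> is enough.\<close>

lemma fuglede_compact:
  fixes T :: "'a::complex_hilbert \<Rightarrow> 'a"
  assumes T: "compact_operator T" "normal_operator T" and S: "bounded_operator S"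
    and comm: "\<And>x. S (T x) = T (S x)"
  shows "S (hilbert_adjoint T x) = hilbert_adjoint T (S x)"
proof -
  obtain E where E: "total_set E" "\<forall>e\<in>E. \<exists>c. T e = c *\<^sub>C e"
    using normal_compact_eigenbasis[OF T] by blast
  note bT' = bounded_operator_adjoint[OF compact_operator_bounded[OF T(1)]]
  have "(\<lambda>x. S (hilbert_adjoint T x)) = (\<lambda>x. hilbert_adjoint T (S x))"
  proof (rule bounded_operator_eqI_total[OF bounded_operator_comp[OF S bT'] bounded_operator_comp[OF bT' S] E(1)])
    fix e assume "e \<in> E"
    then obtain c where c: "T e = c *\<^sub>C e" using E(2) by blast
    have "T (S e) = c *\<^sub>C S e" by (simp add: c comm[symmetric] bounded_operator_linear[OF S])
    from normal_adjoint_eigenvector[OF T(2) this] normal_adjoint_eigenvector[OF T(2) c]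
    show "S (hilbert_adjoint T e) = hilbert_adjoint T (S e)"
      by (simp add: bounded_operator_linear[OF S])
  qed
  then show ?thesis by metis
qed

subsection \<open>Orthonormal families and joint eigenvalue sums\<close>

lemma orthonormal_family_inj: "orthonormal_family k x \<Longrightarrow> inj_on x {..<k}"
  unfolding orthonormal_family_def inj_on_def by (metis lessThan_iff zero_neq_one)

lemma orthonormal_family_set:
  assumes x: "orthonormal_family k x"
  shows "orthonormal_set (x ` {..<k})"
  unfolding orthonormal_set_def
proof clarify
  fix l m assume "l < k" "m < k"
  then show "cinner (x l) (x m) = (if x l = x m then 1 else 0)"
    using x inj_onD[OF orthonormal_family_inj[OF x], of l m] by (auto simp: orthonormal_family_def)
qed

lemma orthonormal_set_independent:
  assumes "orthonormal_set S"
  shows "complex_vector.independent S"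
proof
  assume "complex_vector.dependent S"
  then obtain T u v where T: "finite T" "T \<subseteq> S" "v \<in> T" "u v \<noteq> 0" "(\<Sum>v\<in>T. u v *\<^sub>C v) = 0"
    unfolding complex_vector.dependent_explicit by blast
  then show False using cinner_orthonormal_sum[OF assms T(2,1), of v u] by auto
qed

lemma eigenvector_span_invariant:
  assumes T: "bounded_operator T" and ev: "\<And>x. x \<in> X \<Longrightarrow> \<exists>c. T x = c *\<^sub>C x"
    and v: "v \<in> complex_vector.span X"
  shows "T v \<in> complex_vector.span X"
  using v
proof (induction rule: complex_vector.span_induct_alt)
  case base
  then show ?case by (simp add: bounded_operator_linear[OF T] complex_vector.span_zero)
next
  case (step c x y)
  obtain d where "T x = d *\<^sub>C x" using ev[OF step(1)] by blast
  then show ?case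
    using step by (simp add: bounded_operator_linear[OF T] complex_vector.span_add
        complex_vector.span_scale complex_vector.span_base)
qed

text \<open>Each \<open>A j\<close> becomes triangular:
  \<open>A j u - \<mu> k $ j *\<^sub>C u\<close> lies in the span of the earlier vectors, which is
  orthogonal to \<open>u\<close>. The diagonal values survive although the new vectors need not be
  eigenvectors. The equality of spans serves to recognise invariant subspaces later.\<close>

lemma gram_schmidt_eigenvectors:
  fixes A :: "'m::finite \<Rightarrow> 'a::complex_hilbert \<Rightarrow> 'a"
  assumes bA: "\<And>j. bounded_operator (A j)" and ind: "independent_family k x"
    and ev: "\<And>l. l < k \<Longrightarrow> common_eigenvector A (\<mu> l) (x l)"
  shows "\<exists>y. orthonormal_family k y
    \<and> complex_vector.span (y ` {..<k}) = complex_vector.span (x ` {..<k})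
    \<and> (\<forall>l<k. \<forall>j. cinner (A j (y l)) (y l) = \<mu> l $ j)"
  using ind ev
proof (induction k)
  case 0
  then show ?case by (simp add: orthonormal_family_def)
next
  case (Suc k)
  have xk: "x k \<notin> x ` {..<k}" and inj: "inj_on x {..<k}"
    using Suc.prems(1) by (auto simp: independent_family_def lessThan_Suc)
  have ind: "independent_family k x" and xs: "x k \<notin> complex_vector.span (x ` {..<k})"
    using Suc.prems(1) xk inj
    by (auto simp: independent_family_def lessThan_Suc complex_vector.independent_insert)
  define V where "V = complex_vector.span (x ` {..<k})"
  obtain y where y: "orthonormal_family k y" and yV: "complex_vector.span (y ` {..<k}) = V"
    and yev: "\<And>l j. l < k \<Longrightarrow> cinner (A j (y l)) (y l) = \<mu> l $ j"
    using Suc.IH[OF ind] Suc.prems(2) by (auto simp: V_def)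
  have sub: "complex_vector.subspace V" by (simp add: V_def complex_vector.subspace_span)
  have yinV: "y l \<in> V" if "l < k" for l
    unfolding yV[symmetric] by (rule complex_vector.span_base) (use that in simp)
  define p where "p = (\<Sum>l<k. cinner (x k) (y l) *\<^sub>C y l)"
  have pV: "p \<in> V" unfolding p_def
    by (intro complex_vector.subspace_sum[OF sub] complex_vector.subspace_scale[OF sub] yinV) simp
  define v where "v = x k - p"
  have v0: "v \<noteq> 0" using pV xs by (auto simp: v_def V_def)
  define r where "r = complex_of_real (1 / norm v)"
  define u where "u = r *\<^sub>C v"
  have r0: "r \<noteq> 0" using v0 by (simp add: r_def)
  have vy: "cinner v (y m) = 0" if m: "m < k" for m
  proof -
    have "cinner p (y m) = (\<Sum>l<k. if l = m then cinner (x k) (y m) else 0)"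
      unfolding p_def cinner_sum_left
      by (rule sum.cong) (use y m in \<open>auto simp: orthonormal_family_def cinner_simps\<close>)
    then show ?thesis using m by (simp add: v_def cinner_diff_left)
  qed
  have uV: "cinner z u = 0" if "z \<in> V" for z
  proof -
    have "cinner z v = 0"
      using that unfolding yV[symmetric]
    proof (induction rule: complex_vector.span_induct_alt)
      case (step c w z)
      then show ?case using vy cinner_zero_commute[of w v] by (auto simp: cinner_simps)
    qed simp
    then show ?thesis by (simp add: u_def cinner_simps)
  qed
  have uu: "cinner u u = 1"
    using v0 by (simp add: cinner_self u_def r_def norm_scaleC norm_divide)
  have uy: "cinner (y l) u = 0" "cinner u (y l) = 0" if "l < k" for l
    using uV[OF yinV[OF that]] cinner_zero_commute by blast+
  have Au: "cinner (A j u) u = \<mu> k $ j" for j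
  proof -
    note lin = bounded_operator_linear[OF bA[of j]]
    have xev: "\<exists>c. A j z = c *\<^sub>C z" if "z \<in> x ` {..<k}" for z
      using that Suc.prems(2) by (force simp: common_eigenvector_def)
    have "A j p \<in> V"
      using eigenvector_span_invariant[OF bA xev] pV by (simp add: V_def)
    then have "r *\<^sub>C (\<mu> k $ j *\<^sub>C p - A j p) \<in> V"
      using pV by (intro complex_vector.subspace_scale[OF sub] complex_vector.subspace_diff[OF sub])
    moreover have "A j (x k) = \<mu> k $ j *\<^sub>C x k" using Suc.prems(2)[of k] by (simp add: common_eigenvector_def)
    then have "r *\<^sub>C (\<mu> k $ j *\<^sub>C p - A j p) = A j u - \<mu> k $ j *\<^sub>C u"
      by (simp add: u_def v_def lin complex_vector.scale_right_diff_distrib scaleC_scaleC mult.commute)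
    ultimately have "cinner (A j u - \<mu> k $ j *\<^sub>C u) u = 0" using uV by simp
    then show ?thesis by (simp add: cinner_simps uu)
  qed
  have xk_eq: "x k = inverse r *\<^sub>C u + p"
    using r0 by (simp add: u_def scaleC_scaleC scaleC_one v_def)
  have "complex_vector.span (insert u (y ` {..<k})) = complex_vector.span (insert (x k) (x ` {..<k}))"
  proof (rule subset_antisym)
    have V1: "V \<subseteq> complex_vector.span (insert (x k) (x ` {..<k}))"
      unfolding V_def by (rule complex_vector.span_mono) blast
    have "u \<in> complex_vector.span (insert (x k) (x ` {..<k}))"
      unfolding u_def v_def using V1 pV
      by (intro complex_vector.span_scale complex_vector.span_diff) (auto intro: complex_vector.span_base)
    then show "complex_vector.span (insert u (y ` {..<k})) \<subseteq> complex_vector.span (insert (x k) (x ` {..<k}))"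
      using V1 yinV by (intro complex_vector.span_minimal complex_vector.subspace_span) auto
    have V2: "V \<subseteq> complex_vector.span (insert u (y ` {..<k}))"
      unfolding yV[symmetric] by (rule complex_vector.span_mono) blast
    have "x k \<in> complex_vector.span (insert u (y ` {..<k}))"
      unfolding xk_eq using V2 pV
      by (intro complex_vector.span_scale complex_vector.span_add) (auto intro: complex_vector.span_base)
    moreover have "x ` {..<k} \<subseteq> V" unfolding V_def by (rule complex_vector.span_superset)
    ultimately show "complex_vector.span (insert (x k) (x ` {..<k})) \<subseteq> complex_vector.span (insert u (y ` {..<k}))"
      using V2 by (intro complex_vector.span_minimal complex_vector.subspace_span) auto
  qed
  moreover have "(y(k := u)) ` {..<Suc k} = insert u (y ` {..<k})"
    by (auto simp: lessThan_Suc image_iff)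
  ultimately have sp: "complex_vector.span ((y(k := u)) ` {..<Suc k}) = complex_vector.span (x ` {..<Suc k})"
    by (simp only: lessThan_Suc image_insert)
  have on: "orthonormal_family (Suc k) (y(k := u))"
    using y uy uu by (auto simp: orthonormal_family_def less_Suc_eq)
  have "\<forall>l<Suc k. \<forall>j. cinner (A j ((y(k := u)) l)) ((y(k := u)) l) = \<mu> l $ j"
    using yev Au by (auto simp: less_Suc_eq)
  with sp on show ?case by (intro exI conjI)
qed

lemma joint_eigenvalue_sums_subset_range:
  fixes A :: "'m::finite \<Rightarrow> 'a::complex_hilbert \<Rightarrow> 'a"
  assumes bA: "\<And>j. bounded_operator (A j)"
  shows "joint_eigenvalue_sums k A \<subseteq> joint_numerical_range k A"
proof
  fix w assume "w \<in> joint_eigenvalue_sums k A"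
  then obtain \<mu> x where w: "w = (\<Sum>l<k. \<mu> l)" and x: "independent_family k x"
    "\<And>l. l < k \<Longrightarrow> common_eigenvector A (\<mu> l) (x l)"
    unfolding joint_eigenvalue_sums_def by blast
  obtain y where y: "orthonormal_family k y" "\<forall>l<k. \<forall>j. cinner (A j (y l)) (y l) = \<mu> l $ j"
    using gram_schmidt_eigenvectors[OF bA x] by blast
  have "w = (\<chi> j. \<Sum>l<k. cinner (A j (y l)) (y l))"
    using y(2) by (simp add: w vec_eq_iff)
  then show "w \<in> joint_numerical_range k A" using y(1) unfolding joint_numerical_range_def by blast
qed

section \<open>Joint numerical range in an orthonormal eigenbasis\<close>

lemma has_sum_vec:
  fixes f :: "'i \<Rightarrow> 'b::real_normed_vector ^ 'm::finite"
  assumes "\<And>j. ((\<lambda>e. f e $ j) has_sum (w $ j)) E"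
  shows "(f has_sum w) E"
  using assms unfolding has_sum_def by (intro vec_tendstoI) simp

lemma has_sum_finite_sum:
  fixes f :: "'j \<Rightarrow> 'i \<Rightarrow> 'b::topological_ab_group_add"
  assumes "\<And>l. l \<in> L \<Longrightarrow> (f l has_sum s l) E"
  shows "((\<lambda>e. \<Sum>l\<in>L. f l e) has_sum (\<Sum>l\<in>L. s l)) E"
  using assms by (induction L rule: infinite_finite_induct) (simp_all add: has_sum_add)

text \<open>The sum is the squared length of the projection of \<open>e\<close> onto the span of the
  \<open>x l\<close>, so Bessel's inequality applies.\<close>

lemma orthonormal_family_weight_le_one:
  assumes x: "orthonormal_family k x" and e: "norm e = 1"
  shows "(\<Sum>l<k. (cmod (cinner (x l) e))\<^sup>2) \<le> 1"
proof -
  have "(\<Sum>l<k. (cmod (cinner (x l) e))\<^sup>2) = (\<Sum>f\<in>x ` {..<k}. (cmod (cinner e f))\<^sup>2)"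
    by (simp add: sum.reindex[OF orthonormal_family_inj[OF x]] cmod_cinner_commute[of e])
  also have "\<dots> \<le> (norm e)\<^sup>2" by (rule bessel_inequality[OF orthonormal_family_set[OF x]]) simp
  finally show ?thesis using e by simp
qed

lemma orthonormal_family_weight_has_sum:
  fixes E :: "'a::complex_hilbert set"
  assumes E: "orthonormal_set E" "total_set E" and x: "orthonormal_family k x"
  shows "((\<lambda>e. \<Sum>l<k. (cmod (cinner (x l) e))\<^sup>2) has_sum real k) E"
proof -
  have "((\<lambda>e. \<Sum>l<k. (cmod (cinner (x l) e))\<^sup>2) has_sum (\<Sum>l<k. (norm (x l))\<^sup>2)) E"
    by (rule has_sum_finite_sum) (rule parseval_norm[OF E])
  moreover have "norm (x l) = 1" if "l \<in> {..<k}" for l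
    using x that by (intro norm_one_of_cinner_self) (simp add: orthonormal_family_def)
  ultimately show ?thesis by simp
qed

text \<open>The coefficient of \<open>T (x l)\<close> along \<open>e\<close> is the inner product of
  \<open>x l\<close> with the adjoint image of \<open>e\<close>. The eigenvalue equation is
  therefore stated for the adjoint, and the two conjugations cancel to give
  \<open>c e\<close>.\<close>

lemma eigenbasis_quadratic_form_has_sum:
  fixes T :: "'a::complex_hilbert \<Rightarrow> 'a"
  assumes E: "orthonormal_set E" "total_set E" and T: "bounded_operator T"
    and adj: "\<And>e. e \<in> E \<Longrightarrow> hilbert_adjoint T e = cnj (c e) *\<^sub>C e"
  shows "((\<lambda>e. complex_of_real (\<Sum>l<k. (cmod (cinner (x l) e))\<^sup>2) * c e) has_sum
    (\<Sum>l<k. cinner (T (x l)) (x l))) E"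
proof -
  have "((\<lambda>e. \<Sum>l<k. cinner (T (x l)) e * cnj (cinner (x l) e)) has_sum
      (\<Sum>l<k. cinner (T (x l)) (x l))) E"
    by (rule has_sum_finite_sum) (rule parseval_cinner[OF E])
  moreover have "(\<Sum>l<k. cinner (T (x l)) e * cnj (cinner (x l) e))
      = complex_of_real (\<Sum>l<k. (cmod (cinner (x l) e))\<^sup>2) * c e" if "e \<in> E" for e
  proof -
    have "cinner (T (x l)) e * cnj (cinner (x l) e) = complex_of_real ((cmod (cinner (x l) e))\<^sup>2) * c e" for l
      unfolding complex_norm_square
      by (simp add: cinner_adjoint[OF T] adj[OF that] cinner_scaleC_right)
    then show ?thesis by (simp add: sum_distrib_right)
  qed
  ultimately show ?thesis by (simp cong: has_sum_cong)
qed

lemma numerical_range_in_eigenbasis_hull: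
  fixes A :: "'m::finite \<Rightarrow> 'a::complex_hilbert \<Rightarrow> 'a"
  assumes E: "orthonormal_set E" "total_set E" and bA: "\<And>j. bounded_operator (A j)"
    and adj: "\<And>e j. e \<in> E \<Longrightarrow> hilbert_adjoint (A j) e = cnj (\<mu> e $ j) *\<^sub>C e"
  shows "joint_numerical_range k A \<subseteq> convex hull {sum \<mu> S | S. finite S \<and> S \<subseteq> E \<and> card S = k}"
proof
  fix w assume "w \<in> joint_numerical_range k A"
  then obtain x where x: "orthonormal_family k x"
    and w: "w = (\<chi> j. \<Sum>l<k. cinner (A j (x l)) (x l))" unfolding joint_numerical_range_def by blast
  define p where "p e = (\<Sum>l<k. (cmod (cinner (x l) e))\<^sup>2)" for e
  show "w \<in> convex hull {sum \<mu> S | S. finite S \<and> S \<subseteq> E \<and> card S = k}"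
  proof (rule has_sum_in_convex_hull_subset_sums)
    show "0 \<le> p e \<and> p e \<le> 1" if "e \<in> E" for e
      using orthonormal_family_weight_le_one[OF x orthonormal_set_norm[OF E(1) that]]
      by (simp add: p_def sum_nonneg)
    show "(p has_sum real k) E"
      unfolding p_def[abs_def] by (rule orthonormal_family_weight_has_sum[OF E x])
    show "((\<lambda>e. p e *\<^sub>R \<mu> e) has_sum w) E"
    proof (rule has_sum_vec)
      fix j
      have "((\<lambda>e. complex_of_real (p e) * \<mu> e $ j) has_sum (\<Sum>l<k. cinner (A j (x l)) (x l))) E"
        unfolding p_def by (rule eigenbasis_quadratic_form_has_sum[OF E bA adj])
      then show "((\<lambda>e. (p e *\<^sub>R \<mu> e) $ j) has_sum w $ j) E"
        by (simp add: w scaleR_conv_of_real[of _ "_ :: complex"])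
    qed
  qed
qed

text \<open>By orthonormality of \<open>E\<close> the cross terms vanish, and the quadratic forms
  see only the diagonal of the projection onto the span of the \<open>x l\<close>. Hence a
  projection whose diagonal is the weight function \<open>q\<close> suffices.\<close>

lemma eigenbasis_hull_in_numerical_range:
  fixes A :: "'m::finite \<Rightarrow> 'a::complex_hilbert \<Rightarrow> 'a"
  assumes E: "orthonormal_set E" and bA: "\<And>j. bounded_operator (A j)"
    and ev: "\<And>e j. e \<in> E \<Longrightarrow> A j e = \<mu> e $ j *\<^sub>C e"
  shows "convex hull {sum \<mu> S | S. finite S \<and> S \<subseteq> E \<and> card S = k} \<subseteq> joint_numerical_range k A"
proof
  fix w assume "w \<in> convex hull {sum \<mu> S | S. finite S \<and> S \<subseteq> E \<and> card S = k}"
  from convex_hull_subset_sums_weights[OF this] obtain F q where F: "finite F" "F \<subseteq> E" and q: "\<forall>e\<in>F. 0 \<le> q e \<and> q e \<le> 1" "sum q F = real k"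
    and w: "w = (\<Sum>e\<in>F. q e *\<^sub>R \<mu> e)" by blast
  obtain c :: "nat \<Rightarrow> 'a \<Rightarrow> real" where
    c: "\<And>l m. l < k \<Longrightarrow> m < k \<Longrightarrow> (\<Sum>e\<in>F. c l e * c m e) = (if l = m then 1 else 0)" and
    cq: "\<And>e. e \<in> F \<Longrightarrow> (\<Sum>l<k. (c l e)\<^sup>2) = q e"
    using projection_with_diagonal[OF F(1) bspec[OF q(1)] q(2)] by blast
  define x where "x l = (\<Sum>e\<in>F. complex_of_real (c l e) *\<^sub>C e)" for l
  note onF = orthonormal_set_subset[OF E F(2)]
  have "orthonormal_family k x"
    unfolding orthonormal_family_def
  proof (intro allI impI)
    fix l m assume lm: "l < k" "m < k"
    have "cinner (x l) (x m) = complex_of_real (\<Sum>e\<in>F. c l e * c m e)"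
      by (simp add: x_def cinner_orthonormal_sums[OF onF F(1)])
    then show "cinner (x l) (x m) = (if l = m then 1 else 0)" using c[OF lm] by simp
  qed
  moreover have "w = (\<chi> j. \<Sum>l<k. cinner (A j (x l)) (x l))"
  proof -
    have "w $ j = (\<Sum>l<k. cinner (A j (x l)) (x l))" for j
    proof -
      have "A j (x l) = (\<Sum>e\<in>F. (complex_of_real (c l e) * \<mu> e $ j) *\<^sub>C e)" for l
        unfolding x_def bounded_operator_linear(7)[OF bA]
        by (rule sum.cong) (use F ev in \<open>auto simp: bounded_operator_linear[OF bA] scaleC_scaleC\<close>)
      then have "(\<Sum>l<k. cinner (A j (x l)) (x l))
          = (\<Sum>l<k. \<Sum>e\<in>F. complex_of_real ((c l e)\<^sup>2) * \<mu> e $ j)"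
        by (simp add: x_def cinner_orthonormal_sums[OF onF F(1)] power2_eq_square mult_ac)
      also have "\<dots> = (\<Sum>e\<in>F. complex_of_real (\<Sum>l<k. (c l e)\<^sup>2) * \<mu> e $ j)"
        by (subst sum.swap) (simp add: sum_distrib_right)
      also have "\<dots> = w $ j" by (simp add: w cq scaleR_conv_of_real[of _ "_ :: complex"])
      finally show ?thesis ..
    qed
    then show ?thesis by (simp add: vec_eq_iff)
  qed
  ultimately show "w \<in> joint_numerical_range k A" unfolding joint_numerical_range_def by blast
qed

lemma eigenbasis_sums_subset:
  assumes E: "orthonormal_set E" and ev: "\<And>e j. e \<in> E \<Longrightarrow> A j e = \<mu> e $ j *\<^sub>C e"
  shows "{sum \<mu> S | S. finite S \<and> S \<subseteq> E \<and> card S = k} \<subseteq> joint_eigenvalue_sums k A"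
proof clarify
  fix S assume S: "finite S" "S \<subseteq> E" "k = card S"
  then obtain h where h: "bij_betw h {..<card S} S"
    by (metis ex_bij_betw_nat_finite atLeast0LessThan)
  have "independent_family (card S) h"
    using h orthonormal_set_independent[OF orthonormal_set_subset[OF E S(2)]]
    by (simp add: independent_family_def bij_betw_def)
  moreover have "common_eigenvector A (\<mu> (h l)) (h l)" if "l < card S" for l
  proof -
    have "h l \<in> E" using bij_betwE[OF h] that S(2) by auto
    then show ?thesis using orthonormal_set_norm[OF E, of "h l"] ev
      by (auto simp: common_eigenvector_def)
  qed
  moreover have "sum \<mu> S = (\<Sum>l<card S. \<mu> (h l))" using sum.reindex_bij_betw[OF h, of \<mu>] by simp
  ultimately show "sum \<mu> S \<in> joint_eigenvalue_sums (card S) A"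
    unfolding joint_eigenvalue_sums_def by blast
qed

lemma commuting_normal_numerical_range:
  fixes A :: "'m::finite \<Rightarrow> 'a::complex_hilbert \<Rightarrow> 'a"
  assumes cA: "\<And>j. compact_operator (A j)" and nA: "\<And>j. normal_operator (A j)"
    and comm: "\<And>i j x. A i (A j x) = A j (A i x)"
  shows "joint_numerical_range k A = convex hull (joint_eigenvalue_sums k A)"
proof -
  note bA = compact_operator_bounded[OF cA]
  have comm': "A i (hilbert_adjoint (A j) x) = hilbert_adjoint (A j) (A i x)" for i j x
    by (rule fuglede_compact[OF cA nA bA]) (rule comm)
  have "\<exists>E. orthonormal_set E \<and> total_set E \<and> (\<forall>e\<in>E. \<forall>j. \<exists>c. A j e = c *\<^sub>C e)"
    by (rule commuting_family_eigenbasis) (fact cA comm comm')+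
  then obtain E where E: "orthonormal_set E" "total_set E" and ex: "\<forall>e\<in>E. \<forall>j. \<exists>c. A j e = c *\<^sub>C e"
    by blast
  define \<mu> where "\<mu> e = (\<chi> j. SOME c. A j e = c *\<^sub>C e)" for e
  have ev: "A j e = \<mu> e $ j *\<^sub>C e" if "e \<in> E" for e j
  proof -
    have "\<exists>c. A j e = c *\<^sub>C e" using ex that by simp
    from someI_ex[OF this] show ?thesis by (simp add: \<mu>_def)
  qed
  have adj: "hilbert_adjoint (A j) e = cnj (\<mu> e $ j) *\<^sub>C e" if "e \<in> E" for e j
    by (rule normal_adjoint_eigenvector[OF nA ev[OF that]])
  let ?X = "{sum \<mu> S | S. finite S \<and> S \<subseteq> E \<and> card S = k}"
  show ?thesis
  proof (rule subset_antisym)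
    have "joint_numerical_range k A \<subseteq> convex hull ?X"
      by (rule numerical_range_in_eigenbasis_hull[OF E bA adj])
    also have "\<dots> \<subseteq> convex hull (joint_eigenvalue_sums k A)"
      by (rule hull_mono[OF eigenbasis_sums_subset[OF E(1) ev]])
    finally show "joint_numerical_range k A \<subseteq> convex hull (joint_eigenvalue_sums k A)" .
    \<comment> \<open>The eigenvectors behind an element of the left-hand side need not belong to
      \<open>E\<close>, so the inclusion passes through the numerical range.\<close>
    have "joint_eigenvalue_sums k A \<subseteq> convex hull ?X"
      using joint_eigenvalue_sums_subset_range[OF bA] numerical_range_in_eigenbasis_hull[OF E bA adj]
      by (rule subset_trans)
    then have "convex hull (joint_eigenvalue_sums k A) \<subseteq> convex hull ?X"
      by (rule hull_minimal) (rule convex_convex_hull)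
    also have "\<dots> \<subseteq> joint_numerical_range k A"
      by (rule eigenbasis_hull_in_numerical_range[OF E(1) bA ev])
    finally show "convex hull (joint_eigenvalue_sums k A) \<subseteq> joint_numerical_range k A" .
  qed
qed

subsection \<open>Operators dominated by their eigenvalue sums\<close>

lemma less_hilbert_dimI:
  fixes S :: "'a::complex_hilbert set"
  assumes S: "complex_vector.independent S" "card S = Suc k"
  shows "enat k < hilbert_dim TYPE('a)"
proof (cases "\<exists>B::'a set. finite B \<and> complex_vector.span B = UNIV")
  case True
  then obtain C :: "'a set" where C: "finite C" "complex_vector.span C = UNIV" by blast
  obtain B :: "'a set" where B: "complex_vector.independent B" "UNIV \<subseteq> complex_vector.span B"
    "card B = complex_vector.dim (UNIV :: 'a set)"
    using complex_vector.basis_exists[of UNIV] by metis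
  have "finite B" using complex_vector.independent_span_bound[OF C(1) B(1)] C(2) by simp
  then have "card S \<le> card B" using complex_vector.independent_span_bound[OF _ S(1), of B] B(2) by auto
  then show ?thesis using True B(3) S(2) by (simp add: hilbert_dim_def)
qed (auto simp: hilbert_dim_def)

lemma cinner_span_zero:
  assumes "v \<in> complex_vector.span X" and "\<And>x. x \<in> X \<Longrightarrow> cinner x f = 0"
  shows "cinner v f = 0"
  using assms(1) by (induction rule: complex_vector.span_induct_alt) (simp_all add: cinner_simps assms(2))

text \<open>What the hull inclusion says about a single operator when tested against the real part.
  The vectors \<open>z l\<close> are only independent, since \<open>T\<close> is not yet known to be
  normal.\<close>

definition eigenvalue_sums_dominate :: "('a::complex_hilbert \<Rightarrow> 'a) \<Rightarrow> bool" where
  "eigenvalue_sums_dominate T \<longleftrightarrow> (\<forall>k x. 0 < k \<longrightarrow> enat k < hilbert_dim TYPE('a) \<longrightarrow> orthonormal_family k x \<longrightarrow>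
    (\<exists>z \<nu>. independent_family k z \<and> (\<forall>l<k. T (z l) = \<nu> l *\<^sub>C z l) \<and>
      Re (\<Sum>l<k. cinner (T (x l)) (x l)) \<le> Re (\<Sum>l<k. \<nu> l)))"

text \<open>Images of distinct such eigenvectors are orthogonal and of norm at least
  \<open>t\<close>, hence at mutual distance at least \<open>t\<close>, which excludes a convergent
  subsequence.\<close>

lemma finite_large_eigenvectors:
  fixes B :: "'a::complex_hilbert \<Rightarrow> 'a"
  assumes B: "compact_operator B" and E: "orthonormal_set E"
    and ev: "\<And>e. e \<in> E \<Longrightarrow> B e = complex_of_real (\<beta> e) *\<^sub>C e" and t: "0 < t"
  shows "finite {e\<in>E. t \<le> \<beta> e}"
proof (rule ccontr)
  assume "infinite {e\<in>E. t \<le> \<beta> e}"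
  then obtain g :: "nat \<Rightarrow> 'a" where g: "inj g" "range g \<subseteq> {e\<in>E. t \<le> \<beta> e}"
    using infinite_countable_subset by blast
  have gE: "g n \<in> E" and gt: "t \<le> \<beta> (g n)" for n using g(2) by auto
  have "bounded (range g)"
    by (rule boundedI[of _ 1]) (auto simp: orthonormal_set_norm[OF E gE])
  from compact_operator_subseq[OF B this]
  obtain r l where r: "strict_mono (r :: nat \<Rightarrow> nat)" and l: "(\<lambda>n. B (g (r n))) \<longlonglongrightarrow> l" .
  obtain N where N: "\<And>m n. m \<ge> N \<Longrightarrow> n \<ge> N \<Longrightarrow> dist (B (g (r m))) (B (g (r n))) < t"
    using metric_CauchyD[OF LIMSEQ_imp_Cauchy[OF l] t] by blast
  define a b where "a = g (r N)" and "b = g (r (Suc N))"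
  have ab: "a \<in> E" "b \<in> E" "t \<le> \<beta> a" by (simp_all add: a_def b_def gE gt)
  have "r N \<noteq> r (Suc N)" using strict_monoD[OF r, of N "Suc N"] by simp
  then have "a \<noteq> b" using g(1) by (simp add: a_def b_def inj_eq)
  then have "cinner (complex_of_real (\<beta> a) *\<^sub>C a) (- (complex_of_real (\<beta> b) *\<^sub>C b)) = 0"
    using orthonormal_setD[OF E ab(1,2)] by (simp add: cinner_simps)
  from norm_add_pythagoras[OF this]
  have "(norm (B a - B b))\<^sup>2 = (norm (B a))\<^sup>2 + (norm (B b))\<^sup>2" by (simp add: ev[OF ab(1)] ev[OF ab(2)])
  also have "\<dots> \<ge> (\<beta> a)\<^sup>2"
    using orthonormal_set_norm[OF E ab(1)] by (simp add: ev[OF ab(1)] norm_scaleC power_mult_distrib)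
  finally have "(\<beta> a)\<^sup>2 \<le> (norm (B a - B b))\<^sup>2" .
  moreover have "t\<^sup>2 \<le> (\<beta> a)\<^sup>2" using t ab(3) by (intro power_mono) auto
  ultimately have "t\<^sup>2 \<le> (norm (B a - B b))\<^sup>2" by simp
  then have "t \<le> norm (B a - B b)" by (rule power2_le_imp_le) simp
  then show False using N[of N "Suc N"] by (simp add: dist_norm a_def b_def)
qed

text \<open>
  The eigenvectors of the real part of \<open>T\<close> with eigenvalue at least \<open>\<beta> e\<close> span a space on which the
  trace of the real part attains Ky Fan's bound. By the equality case, this space is also
  spanned by eigenvectors of \<open>T\<close>, so it reduces \<open>T\<close>.
\<close>
lemma dominated_reducing:
  fixes T :: "'a::complex_hilbert \<Rightarrow> 'a"
  assumes cT: "compact_operator T" and dom: "eigenvalue_sums_dominate T"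
    and E: "orthonormal_set E" "total_set E"
    and ev: "\<And>e. e \<in> E \<Longrightarrow> T e + hilbert_adjoint T e = complex_of_real (\<beta> e) *\<^sub>C e"
    and e: "e \<in> E" "0 < \<beta> e" and f: "f \<in> E" "\<beta> f < \<beta> e"
  shows "cinner (T e) f = 0 \<and> cinner (T f) e = 0"
proof -
  note bT = compact_operator_bounded[OF cT]
  define B where "B x = T x + hilbert_adjoint T x" for x
  have cB: "compact_operator B"
    unfolding B_def[abs_def] by (rule compact_operator_add[OF cT compact_operator_adjoint[OF cT]])
  have ReB: "Re (cinner (B x) x) = 2 * Re (cinner (T x) x)" for x
  proof -
    have "cinner (hilbert_adjoint T x) x = cnj (cinner (T x) x)"
      using cinner_adjoint_left[OF bT, of x x] cinner_commute[of x "T x"] by simp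
    then show ?thesis by (simp add: B_def cinner_add_left)
  qed
  have adjB: "hilbert_adjoint B = B"
    by (rule adjoint_eqI[OF compact_operator_bounded[OF cB]])
      (simp add: B_def cinner_simps cinner_adjoint[OF bT] cinner_adjoint_left[OF bT])
  have evB: "B g = complex_of_real (\<beta> g) *\<^sub>C g" if "g \<in> E" for g
    using ev[OF that] by (simp add: B_def)
  \<comment> \<open>The threshold is \<open>\<beta> e\<close> itself, so \<open>F\<close> contains
    \<open>e\<close> and every basis vector with the same eigenvalue but not \<open>f\<close>;
    positivity of \<open>\<beta> e\<close> makes it finite.\<close>
  define F where "F = {g\<in>E. \<beta> e \<le> \<beta> g}"
  define k where "k = card F"
  have finF: "finite F" unfolding F_def by (rule finite_large_eigenvectors[OF cB E(1) evB e(2)])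
  have FE: "F \<subseteq> E" and eF: "e \<in> F" and fF: "f \<notin> F" using e f by (auto simp: F_def)
  have k0: "0 < k" using eF finF by (auto simp: k_def card_gt_0_iff)
  \<comment> \<open>The vector \<open>f\<close> outside \<open>F\<close> is the additional
    independent one that makes \<open>k\<close> strictly smaller than the dimension.\<close>
  have "insert f F \<subseteq> E" using f FE by simp
  then have "complex_vector.independent (insert f F)"
    by (intro orthonormal_set_independent orthonormal_set_subset[OF E(1)])
  then have kdim: "enat k < hilbert_dim TYPE('a)"
    by (rule less_hilbert_dimI) (use finF fF in \<open>simp add: k_def\<close>)
  obtain h where h: "bij_betw h {..<k} F"
    using ex_bij_betw_nat_finite[OF finF] by (auto simp: k_def atLeast0LessThan)
  have hE: "h l \<in> E" if "l < k" for l using bij_betwE[OF h] that FE by auto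
  have h_eq: "h l = h m \<longleftrightarrow> l = m" if "l < k" "m < k" for l m
    using h that by (auto simp: bij_betw_def inj_on_def)
  have onh: "orthonormal_family k h"
    by (simp add: orthonormal_family_def orthonormal_setD[OF E(1) hE hE] h_eq)
  have ReT: "2 * Re (cinner (T g) g) = \<beta> g" if "g \<in> E" for g
    using ReB[of g] orthonormal_setD[OF E(1) that that] by (simp add: evB[OF that] cinner_scaleC_left)
  have "2 * Re (\<Sum>l<k. cinner (T (h l)) (h l)) = (\<Sum>l<k. \<beta> (h l))"
    by (simp add: sum_distrib_left ReT hE)
  also have "\<dots> = sum \<beta> F" by (rule sum.reindex_bij_betw[OF h])
  finally have trace_h: "2 * Re (\<Sum>l<k. cinner (T (h l)) (h l)) = sum \<beta> F" .
  obtain z \<nu> where z: "independent_family k z" and zev: "\<forall>l<k. T (z l) = \<nu> l *\<^sub>C z l"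
    and z_ge: "Re (\<Sum>l<k. cinner (T (h l)) (h l)) \<le> Re (\<Sum>l<k. \<nu> l)"
    using dom k0 kdim onh unfolding eigenvalue_sums_dominate_def by blast
  have z0: "z l \<noteq> 0" if "l < k" for l
    using z that complex_vector.dependent_zero unfolding independent_family_def by (metis imageI lessThan_iff)
  have "common_eigenvector (\<lambda>_::unit. T) (\<chi> _. \<nu> l) (z l)" if "l < k" for l
    using zev z0 that by (simp add: common_eigenvector_def)
  \<comment> \<open>Orthonormalising the \<open>z l\<close> keeps their span and the values
    \<open>\<nu> l\<close>, so the trace of \<open>B\<close> over \<open>y\<close> is at least the
    one over \<open>h\<close>.\<close>
  from gram_schmidt_eigenvectors[OF bT z this]
  obtain y where y: "orthonormal_family k y"
    and ysp: "complex_vector.span (y ` {..<k}) = complex_vector.span (z ` {..<k})"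
    and yT: "\<forall>l<k. cinner (T (y l)) (y l) = \<nu> l" by auto
  define p where "p g = (\<Sum>l<k. (cmod (cinner (y l) g))\<^sup>2)" for g
  define v where "v = Re (\<Sum>l<k. cinner (B (y l)) (y l))"
  have p: "0 \<le> p g \<and> p g \<le> 1" if "g \<in> E" for g
    using orthonormal_family_weight_le_one[OF y orthonormal_set_norm[OF E(1) that]]
    by (simp add: p_def sum_nonneg)
  have pk: "(p has_sum real k) E"
    unfolding p_def[abs_def] by (rule orthonormal_family_weight_has_sum[OF E y])
  have "((\<lambda>g. complex_of_real (p g) * complex_of_real (\<beta> g)) has_sum
      (\<Sum>l<k. cinner (B (y l)) (y l))) E"
    unfolding p_def
    by (rule eigenbasis_quadratic_form_has_sum[OF E compact_operator_bounded[OF cB]])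
      (simp add: adjB evB)
  from has_sum_Re[OF this] have pv: "((\<lambda>g. p g * \<beta> g) has_sum v) E" by (simp add: v_def)
  have "v = 2 * Re (\<Sum>l<k. cinner (T (y l)) (y l))" by (simp add: v_def ReB sum_distrib_left)
  also have "\<dots> = 2 * Re (\<Sum>l<k. \<nu> l)" using yT by simp
  finally have v_ge: "sum \<beta> F \<le> v" using z_ge trace_h by linarith
  have eq: "p g * (\<beta> g - \<beta> e) = (if g \<in> F then \<beta> g - \<beta> e else 0)" if "g \<in> E" for g
  proof (rule bathtub_equality[OF p pk pv finF FE _ _ _ that])
    show "sum \<beta> F + (real k - real (card F)) * \<beta> e \<le> v" using v_ge by (simp add: k_def)
  qed (auto simp: F_def)
  have p_out: "p g = 0" if "g \<in> E" "g \<notin> F" for g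
    using eq[OF that(1)] that by (auto simp: F_def)
  \<comment> \<open>At \<open>g = e\<close> the identity \<open>eq\<close> is void because its
    factor vanishes. The total mass settles this case: weights at most 1 on the \<open>k\<close>
    elements of \<open>F\<close> that sum to \<open>k\<close> are all equal to 1.\<close>
  have "(p has_sum sum p F) E"
    by (rule has_sum_finite_neutralI[OF finF FE]) (simp_all add: p_out)
  then have "sum p F = real k" using pk has_sum_unique by blast
  then have "(\<Sum>g\<in>F. 1 - p g) = 0" by (simp add: sum_subtractf k_def)
  moreover have "0 \<le> 1 - p g" if "g \<in> F" for g using p[of g] that FE by auto
  ultimately have "1 - p e = 0" using sum_nonneg_0[OF finF, of "\<lambda>g. 1 - p g"] eF by blast
  then have pe: "p e = 1" by simp
  let ?Y = "y ` {..<k}"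
  \<comment> \<open>\<open>p e\<close> is the squared length of the projection of the unit vector
    \<open>e\<close> onto the span of \<open>?Y\<close>; the value 1 puts \<open>e\<close> into that
    span.\<close>
  have "(\<Sum>g\<in>?Y. (cmod (cinner e g))\<^sup>2) = p e"
    by (simp add: sum.reindex[OF orthonormal_family_inj[OF y]] p_def cmod_cinner_commute[of e])
  then have "norm (e - (\<Sum>g\<in>?Y. cinner e g *\<^sub>C g)) = 0"
    using norm_orthonormal_remainder[OF orthonormal_family_set[OF y], of e]
      orthonormal_set_norm[OF E(1) e(1)] pe by simp
  then have "e = (\<Sum>g\<in>?Y. cinner e g *\<^sub>C g)" by simp
  also have "\<dots> \<in> complex_vector.span ?Y"
    by (intro complex_vector.span_sum complex_vector.span_scale complex_vector.span_base)
  finally have "e \<in> complex_vector.span (z ` {..<k})" by (simp add: ysp)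
  then have "T e \<in> complex_vector.span (z ` {..<k})"
    by (rule eigenvector_span_invariant[OF bT, rotated]) (use zev in auto)
  then have "T e \<in> complex_vector.span ?Y" by (simp add: ysp)
  moreover have yf: "cinner g f = 0" if "g \<in> ?Y" for g
    using p_out[OF f(1) fF] that by (auto simp: p_def sum_nonneg_eq_0_iff)
  ultimately have Tef: "cinner (T e) f = 0" by (rule cinner_span_zero)
  \<comment> \<open>The second entry comes through the adjoint: \<open>B e\<close> is a multiple of
    \<open>e\<close> and thus orthogonal to \<open>f\<close>, so orthogonality of \<open>T e\<close>
    to \<open>f\<close> passes to the adjoint image of \<open>e\<close>.\<close>
  have "e \<noteq> f" using f(2) by auto
  then have "cinner (B e) f = 0"
    using orthonormal_setD[OF E(1) e(1) f(1)] by (simp add: evB[OF e(1)] cinner_simps)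
  then have "cinner (hilbert_adjoint T e) f = 0" using Tef by (simp add: B_def cinner_simps)
  then have "cinner e (T f) = 0" by (simp add: cinner_adjoint_left[OF bT])
  then show ?thesis using Tef cinner_zero_commute by blast
qed

text \<open>Normality amounts to \<open>T\<close> commuting with \<open>B\<close>, because
  \<open>T (T x)\<close> cancels. For this the matrix entries of \<open>T\<close> between
  eigenvectors of \<open>B\<close> with different eigenvalues have to vanish.\<close>

lemma dominated_normal:
  fixes T :: "'a::complex_hilbert \<Rightarrow> 'a"
  assumes cT: "compact_operator T" and dom: "eigenvalue_sums_dominate T"
    and dom': "eigenvalue_sums_dominate (\<lambda>x. - T x)"
  shows "normal_operator T"
proof -
  note bT = compact_operator_bounded[OF cT] and adj = cinner_adjoint_left[OF compact_operator_bounded[OF cT]]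
  note lin = bounded_operator_linear[OF bT]
  define B where "B x = T x + hilbert_adjoint T x" for x
  have cB: "compact_operator B"
    unfolding B_def[abs_def] by (rule compact_operator_add[OF cT compact_operator_adjoint[OF cT]])
  note bB = compact_operator_bounded[OF cB]
  have sB: "self_adjoint B"
    by (simp add: self_adjoint_def B_def cinner_simps adj cinner_adjoint[OF bT])
  have "\<exists>E. orthonormal_set E \<and> total_set E \<and> (\<forall>e\<in>E. \<forall>C\<in>{B}. \<exists>c. C e = c *\<^sub>C e)"
    by (rule joint_eigenbasis_exists) (use cB sB in auto)
  then obtain E where E: "orthonormal_set E" "total_set E" and ex: "\<forall>e\<in>E. \<exists>c. B e = c *\<^sub>C e" by auto
  define \<beta> where "\<beta> e = Re (cinner (B e) e)" for e
  have evB: "B e = complex_of_real (\<beta> e) *\<^sub>C e" if e: "e \<in> E" for e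
  proof -
    obtain c where c: "B e = c *\<^sub>C e" using ex e by blast
    have ee: "cinner e e = 1" using orthonormal_setD[OF E(1) e e] by simp
    have "c = cnj c" using self_adjointD[OF sB, of e e] by (simp add: c cinner_simps ee)
    then have "c = complex_of_real (Re c)" by (simp add: complex_eq_iff)
    moreover have "\<beta> e = Re c" by (simp add: \<beta>_def c cinner_simps ee)
    ultimately show ?thesis using c by simp
  qed
  have evT: "T e + hilbert_adjoint T e = complex_of_real (\<beta> e) *\<^sub>C e" if "e \<in> E" for e
    using evB[OF that] by (simp add: B_def)
  have cT': "compact_operator (\<lambda>x. - T x)"
    using compact_operator_scaleC[OF cT, of "-1"] by (simp add: scaleC_minus1)
  have adjT': "hilbert_adjoint (\<lambda>x. - T x) = (\<lambda>x. - hilbert_adjoint T x)"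
    by (rule adjoint_eqI[OF compact_operator_bounded[OF cT']])
      (simp add: cinner_simps cinner_adjoint[OF bT])
  have evT': "- T e + hilbert_adjoint (\<lambda>x. - T x) e = complex_of_real (- \<beta> e) *\<^sub>C e" if "e \<in> E" for e
    using arg_cong[OF evT[OF that], of uminus]
    by (simp add: adjT' complex_vector.scale_minus_left)
  \<comment> \<open>If \<open>\<beta> e\<close> is not positive, then \<open>- \<beta> f\<close> is,
    and the reduction is applied to \<open>- T\<close> with \<open>e\<close> and \<open>f\<close>
    exchanged.\<close>
  have sep: "cinner (T e) f = 0 \<and> cinner (T f) e = 0" if ef: "e \<in> E" "f \<in> E" "\<beta> f < \<beta> e" for e f
  proof (cases "0 < \<beta> e")
    case True
    then show ?thesis using dominated_reducing[OF cT dom E evT ef(1) _ ef(2)] ef(3) by blast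
  next
    case False
    then show ?thesis
      using dominated_reducing[OF cT' dom' E evT' ef(2) _ ef(1)] ef(3) by (simp add: cinner_simps)
  qed
  then have sep': "cinner (T e) f = 0" if "e \<in> E" "f \<in> E" "\<beta> e \<noteq> \<beta> f" for e f
    using that by (metis linorder_neqE_linordered_idom)
  have TB: "(\<lambda>x. T (B x)) = (\<lambda>x. B (T x))"
  proof (rule bounded_operator_eqI_total[OF bounded_operator_comp[OF bT bB] bounded_operator_comp[OF bB bT] E(2)])
    fix e assume e: "e \<in> E"
    have "B (T e) - complex_of_real (\<beta> e) *\<^sub>C T e = 0"
    proof (rule total_setD[OF E(2)])
      fix f assume f: "f \<in> E"
      have "cinner (B (T e)) f = complex_of_real (\<beta> f) * cinner (T e) f"
        by (simp add: self_adjointD[OF sB] evB[OF f] cinner_simps)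
      then show "cinner (B (T e) - complex_of_real (\<beta> e) *\<^sub>C T e) f = 0"
        using sep'[OF e f] by (cases "\<beta> e = \<beta> f") (simp_all add: cinner_simps)
    qed
    then show "T (B e) = B (T e)" by (simp add: evB[OF e] lin)
  qed
  have "T (hilbert_adjoint T x) = hilbert_adjoint T (T x)" for x
    using fun_cong[OF TB, of x] by (simp add: B_def lin)
  then show ?thesis using bT by (simp add: normal_operator_def fun_eq_iff)
qed

text \<open>If all of \<open>X\<close> lay strictly below the value at \<open>w\<close>, so would
  its hull. This yields an actual element of \<open>X\<close> and not merely a supremum.\<close>

lemma hull_linear_bound:
  fixes g :: "'a::real_vector \<Rightarrow> real"
  assumes "linear g" and w: "w \<in> convex hull X"
  shows "\<exists>s\<in>X. g w \<le> g s"
proof (rule ccontr)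
  assume "\<not> ?thesis"
  then have "X \<subseteq> g -` {..<g w}" by force
  then have "convex hull X \<subseteq> g -` {..<g w}"
    by (rule hull_minimal) (intro convex_linear_vimage assms(1) convex_real_interval)
  then show False using w by auto
qed

text \<open>The inclusion is tested against the real functional \<open>g\<close>; a common
  eigenvector is an eigenvector of every linear combination. Arbitrary \<open>a\<close> and
  \<open>b\<close> cover the pencils and, after a change of sign, their negatives.\<close>

lemma numerical_range_dominate:
  fixes A :: "'m::finite \<Rightarrow> 'a::complex_hilbert \<Rightarrow> 'a"
  assumes W: "\<And>k. 0 < k \<Longrightarrow> enat k < hilbert_dim TYPE('a) \<Longrightarrow>
      joint_numerical_range k A \<subseteq> convex hull (joint_eigenvalue_sums k A)"
  shows "eigenvalue_sums_dominate (\<lambda>x. a *\<^sub>C A i x + b *\<^sub>C A j x)"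
  unfolding eigenvalue_sums_dominate_def
proof (intro allI impI)
  fix k and x :: "nat \<Rightarrow> 'a"
  assume k: "0 < k" "enat k < hilbert_dim TYPE('a)" and x: "orthonormal_family k x"
  define g where "g w = Re (a * w $ i + b * w $ j)" for w :: "complex ^ 'm"
  define w where "w = (\<chi> j. \<Sum>l<k. cinner (A j (x l)) (x l))"
  have "linear g"
    by (rule linearI) (simp_all add: g_def algebra_simps)
  moreover have "w \<in> joint_numerical_range k A" unfolding joint_numerical_range_def w_def using x by blast
  then have "w \<in> convex hull (joint_eigenvalue_sums k A)" using W[OF k] by blast
  ultimately obtain s where s: "s \<in> joint_eigenvalue_sums k A" "g w \<le> g s" using hull_linear_bound by blast
  obtain \<mu> z where sm: "s = (\<Sum>l<k. \<mu> l)" and z: "independent_family k z"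
    and ev: "\<forall>l<k. common_eigenvector A (\<mu> l) (z l)"
    using s(1) unfolding joint_eigenvalue_sums_def by blast
  define \<nu> where "\<nu> l = a * \<mu> l $ i + b * \<mu> l $ j" for l
  have "a *\<^sub>C A i (z l) + b *\<^sub>C A j (z l) = \<nu> l *\<^sub>C z l" if "l < k" for l
    using ev that by (simp add: common_eigenvector_def \<nu>_def scaleC_scaleC scaleC_add_left)
  moreover have "Re (\<Sum>l<k. cinner (a *\<^sub>C A i (x l) + b *\<^sub>C A j (x l)) (x l)) = g w"
    by (simp add: g_def w_def cinner_simps sum.distrib sum_distrib_left)
  moreover have "Re (\<Sum>l<k. \<nu> l) = g s"
    by (simp add: g_def sm \<nu>_def sum.distrib sum_distrib_left)
  ultimately show "\<exists>z \<nu>. independent_family k z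
      \<and> (\<forall>l<k. a *\<^sub>C A i (z l) + b *\<^sub>C A j (z l) = \<nu> l *\<^sub>C z l)
      \<and> Re (\<Sum>l<k. cinner (a *\<^sub>C A i (x l) + b *\<^sub>C A j (x l)) (x l)) \<le> Re (\<Sum>l<k. \<nu> l)"
    using z s(2) by (intro exI[of _ z] exI[of _ \<nu>]) simp
qed

text \<open>Polarisation: normality of the pencil reads
  \<open>cnj c *\<^sub>C D + c *\<^sub>C G = 0\<close>. The choice \<open>c = 1\<close> gives
  \<open>D + G = 0\<close> and \<open>c = \<i>\<close> gives \<open>G = D\<close>, so
  \<open>D\<close> vanishes.\<close>

lemma normal_pencil_adjoint_commute:
  fixes S T :: "'a::complex_hilbert \<Rightarrow> 'a"
  assumes S: "normal_operator S" and T: "normal_operator T"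
    and N: "\<And>c. normal_operator (\<lambda>x. S x + c *\<^sub>C T x)"
  shows "S (hilbert_adjoint T x) = hilbert_adjoint T (S x)"
proof -
  have bS: "bounded_operator S" and bT: "bounded_operator T" using S T by (simp_all add: normal_operator_def)
  let ?S = "hilbert_adjoint S" and ?T = "hilbert_adjoint T"
  note lin = bounded_operator_linear[OF bS] bounded_operator_linear[OF bT]
    bounded_operator_linear[OF bounded_operator_adjoint[OF bS]]
    bounded_operator_linear[OF bounded_operator_adjoint[OF bT]]
  define D G where "D = S (?T x) - ?T (S x)" and "G = T (?S x) - ?S (T x)"
  have eq: "cnj c *\<^sub>C D + c *\<^sub>C G = 0" for c
  proof -
    have "hilbert_adjoint (\<lambda>x. S x + c *\<^sub>C T x) = (\<lambda>x. ?S x + cnj c *\<^sub>C ?T x)"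
      using N[of c] by (intro adjoint_eqI)
        (simp_all add: normal_operator_def cinner_simps cinner_adjoint[OF bS] cinner_adjoint[OF bT])
    with normal_operatorD[OF N[of c], of x]
    have "S (?S x) + cnj c *\<^sub>C S (?T x) + (c *\<^sub>C T (?S x) + (c * cnj c) *\<^sub>C T (?T x))
        = ?S (S x) + c *\<^sub>C ?S (T x) + (cnj c *\<^sub>C ?T (S x) + (c * cnj c) *\<^sub>C ?T (T x))"
      by (simp add: lin scaleC_add_right scaleC_scaleC mult.commute)
    then show ?thesis
      by (simp add: D_def G_def normal_operatorD[OF S] normal_operatorD[OF T]
          complex_vector.scale_right_diff_distrib algebra_simps)
  qed
  have "\<i> *\<^sub>C (G - D) = 0" using eq[of \<i>]
    by (simp add: complex_vector.scale_right_diff_distrib complex_vector.scale_minus_left)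
  then have "G = D" by simp
  moreover have "D + G = 0" using eq[of 1] by (simp add: scaleC_one)
  ultimately have "2 *\<^sub>R D = 0" by (simp add: scaleR_2)
  then show ?thesis by (simp add: D_def)
qed

lemma normal_operator_adjoint:
  assumes T: "normal_operator T"
  shows "normal_operator (hilbert_adjoint T)"
proof -
  have bT: "bounded_operator T" using T by (simp add: normal_operator_def)
  then show ?thesis using T
    by (simp add: normal_operator_def bounded_operator_adjoint adjoint_adjoint)
qed

theorem theorem6p1:
  fixes A :: "'m::finite \<Rightarrow> 'h::complex_hilbert \<Rightarrow> 'h"
  assumes "\<forall>j. compact_operator (A j)"
  shows "((\<forall>i j. A i \<circ> A j = A j \<circ> A i) \<and> (\<forall>j. normal_operator (A j))) \<longleftrightarrow>
    (\<forall>k::nat. 0 < k \<and> enat k < hilbert_dim TYPE('h) \<longrightarrow>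
      joint_numerical_range k A = convex hull (joint_eigenvalue_sums k A))"
proof
  have cA: "compact_operator (A j)" for j using assms by blast
  show "\<forall>k::nat. 0 < k \<and> enat k < hilbert_dim TYPE('h) \<longrightarrow>
      joint_numerical_range k A = convex hull (joint_eigenvalue_sums k A)"
    if "(\<forall>i j. A i \<circ> A j = A j \<circ> A i) \<and> (\<forall>j. normal_operator (A j))"
  proof (intro allI impI)
    fix k
    have "A i (A j x) = A j (A i x)" for i j x using that by (metis comp_apply)
    moreover have "normal_operator (A j)" for j using that by blast
    ultimately show "joint_numerical_range k A = convex hull (joint_eigenvalue_sums k A)"
      by (intro commuting_normal_numerical_range cA)
  qed
  assume W: "\<forall>k::nat. 0 < k \<and> enat k < hilbert_dim TYPE('h) \<longrightarrow>
      joint_numerical_range k A = convex hull (joint_eigenvalue_sums k A)"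
  have normal2: "normal_operator (\<lambda>x. a *\<^sub>C A i x + b *\<^sub>C A j x)" for a b i j
  proof (rule dominated_normal)
    show "compact_operator (\<lambda>x. a *\<^sub>C A i x + b *\<^sub>C A j x)"
      by (intro compact_operator_add compact_operator_scaleC cA)
    have dom: "eigenvalue_sums_dominate (\<lambda>x. a *\<^sub>C A i x + b *\<^sub>C A j x)" for a b
      by (rule numerical_range_dominate) (use W in simp)
    show "eigenvalue_sums_dominate (\<lambda>x. a *\<^sub>C A i x + b *\<^sub>C A j x)" by (rule dom)
    show "eigenvalue_sums_dominate (\<lambda>x. - (a *\<^sub>C A i x + b *\<^sub>C A j x))"
      using dom[of "- a" "- b"] by (simp add: complex_vector.scale_minus_left)
  qed
  have nA: "normal_operator (A j)" for j
    using normal2[of 1 j 0 j] by (simp add: scaleC_one)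
  have pencil: "normal_operator (\<lambda>x. A i x + c *\<^sub>C A j x)" for i j c
    using normal2[of 1 i c j] by (simp add: scaleC_one)
  have "A i (A j x) = A j (A i x)" for i j x
  proof -
    have "A i (hilbert_adjoint (A j) x) = hilbert_adjoint (A j) (A i x)" for x
      by (rule normal_pencil_adjoint_commute[OF nA nA pencil])
    \<comment> \<open>Fuglede's theorem is applied to the adjoint of \<open>A j\<close>, again
      compact and normal; the commutation it returns is with the adjoint of that operator, which is
      \<open>A j\<close>.\<close>
    from fuglede_compact[OF compact_operator_adjoint[OF cA] normal_operator_adjoint[OF nA]
        compact_operator_bounded[OF cA] this]
    show ?thesis by (simp add: adjoint_adjoint[OF compact_operator_bounded[OF cA]])
  qed
  then show "(\<forall>i j. A i \<circ> A j = A j \<circ> A i) \<and> (\<forall>j. normal_operator (A j))"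
    using nA by (simp add: fun_eq_iff)
qed

end
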